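(* Let $H$ be a quadratic numerical semigroup minimally generated by $a_1<\dots<a_n$ such that $\operatorname{gr}_{\mathfrak m}K[H]$ is Cohen–Macaulay. Then: (a) either $n\leq e(H)\leq 2^{n-1}-2^{n-3}$, or $e(H)=2^{n-1}$; (b) if $e(H)=2^{n-1}-2^{n-3}$, then $I_H^*$ is an almost complete intersection ideal. Moreover, in the situation of (b), $I_H^*$ has a Gröbner basis consisting of quadrics with respect to the degree reverse lexicographic order induced by $x_n>\dots>x_1$.
   Context: A numerical semigroup is a submonoid $H\subseteq\mathbb{N}$ with $\mathbb{N}\setminus H$ finite; $G(H)$ is its minimal generating set and $e(H)=\min G(H)$. $K$ is a field, $K[H]=\bigoplus_{h\in H}Kt^h\subseteq K[t]$ with maximal ideal $\mathfrak m=(t^h:h\in H\setminus\{0\})$. With $G(H)=\{a_1<\dots<a_n\}$, $S=K[x_1,\dots,x_n]$ and $I_H=\ker(S\to K[H],\ x_i\mapsto t^{a_i})$. For $0\ne f\in S$, $f^*$ is its homogeneous component of least degree; $I^*=(f^*:0\neq f\in I)$. Then $\operatorname{gr}_{\mathfrak m}K[H]\cong S/I_H^*$. $H$ is quadratic if $I_H^*$ is generated by homogeneous polynomials of degree 2. An ideal $I$ is an almost complete intersection ideal if its minimal number of generators equals $\operatorname{height} I+1$. *)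

theory Defs
  imports "HOL-Library.Poly_Mapping" "HOL-Library.Extended_Nat" "HOL-Library.Cardinality"
    "HOL-Computational_Algebra.Polynomial"
begin

definition numerical_semigroup :: "nat set \<Rightarrow> bool" where
  "numerical_semigroup H \<longleftrightarrow> 0 \<in> H \<and> (\<forall>x\<in>H. \<forall>y\<in>H. x + y \<in> H) \<and> finite (UNIV - H)"

definition monoid_gen :: "nat set \<Rightarrow> nat set" where
  "monoid_gen A = \<Inter>{M. 0 \<in> M \<and> A \<subseteq> M \<and> (\<forall>x\<in>M. \<forall>y\<in>M. x + y \<in> M)}"

definition minimal_gen_set :: "nat set \<Rightarrow> nat set \<Rightarrow> bool" where
  "minimal_gen_set H G \<longleftrightarrow> monoid_gen G = H \<and> (\<forall>G'. G' \<subset> G \<longrightarrow> monoid_gen G' \<noteq> H)"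

type_synonym ('n, 'k) mpoly = "('n \<Rightarrow>\<^sub>0 nat) \<Rightarrow>\<^sub>0 'k"

definition mdeg :: "('n \<Rightarrow>\<^sub>0 nat) \<Rightarrow> nat" where
  "mdeg \<alpha> = (\<Sum>i\<in>Poly_Mapping.keys \<alpha>. Poly_Mapping.lookup \<alpha> i)"

definition homogeneous :: "nat \<Rightarrow> ('n, 'k::zero) mpoly \<Rightarrow> bool" where
  "homogeneous d f \<longleftrightarrow> (\<forall>\<alpha>\<in>Poly_Mapping.keys f. mdeg \<alpha> = d)"

definition hcomp :: "nat \<Rightarrow> ('n, 'k::zero) mpoly \<Rightarrow> ('n, 'k) mpoly" where
  "hcomp d f = Abs_poly_mapping (\<lambda>\<alpha>. if mdeg \<alpha> = d then Poly_Mapping.lookup f \<alpha> else 0)"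

definition initial_form :: "('n, 'k::zero) mpoly \<Rightarrow> ('n, 'k) mpoly" where
  "initial_form f = hcomp (Min (mdeg ` Poly_Mapping.keys f)) f"

definition is_ideal :: "'a::comm_ring_1 set \<Rightarrow> bool" where
  "is_ideal I \<longleftrightarrow> 0 \<in> I \<and> (\<forall>x\<in>I. \<forall>y\<in>I. x + y \<in> I) \<and> (\<forall>r. \<forall>x\<in>I. r * x \<in> I)"

definition ideal_gen :: "'a::comm_ring_1 set \<Rightarrow> 'a set" where
  "ideal_gen G = \<Inter>{I. is_ideal I \<and> G \<subseteq> I}"

definition prime_ideal :: "'a::comm_ring_1 set \<Rightarrow> bool" where
  "prime_ideal P \<longleftrightarrow> is_ideal P \<and> P \<noteq> UNIV \<and> (\<forall>x y. x * y \<in> P \<longrightarrow> x \<in> P \<or> y \<in> P)"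

definition krull_dim_quot :: "'a::comm_ring_1 set \<Rightarrow> enat" where
  "krull_dim_quot I = Sup {enat k | k. \<exists>P :: nat \<Rightarrow> 'a set.
      (\<forall>i\<le>k. prime_ideal (P i) \<and> I \<subseteq> P i) \<and> (\<forall>i<k. P i \<subset> P (Suc i))}"

definition prime_height :: "'a::comm_ring_1 set \<Rightarrow> enat" where
  "prime_height P = Sup {enat k | k. \<exists>Q :: nat \<Rightarrow> 'a set.
      (\<forall>i\<le>k. prime_ideal (Q i)) \<and> (\<forall>i<k. Q i \<subset> Q (Suc i)) \<and> Q k = P}"

definition ideal_height :: "'a::comm_ring_1 set \<Rightarrow> enat" where
  "ideal_height I = Inf {prime_height P | P. prime_ideal P \<and> I \<subseteq> P}"

definition num_gens :: "'a::comm_ring_1 set \<Rightarrow> nat" where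
  "num_gens I = (LEAST k. \<exists>G. finite G \<and> card G = k \<and> ideal_gen G = I)"

definition almost_complete_intersection :: "'a::comm_ring_1 set \<Rightarrow> bool" where
  "almost_complete_intersection I \<longleftrightarrow> enat (num_gens I) = ideal_height I + 1"

definition hom_max_ideal :: "('n, 'k::zero) mpoly set" where
  "hom_max_ideal = {f. Poly_Mapping.lookup f 0 = 0}"

definition regular_seq_quot :: "('n, 'k::field) mpoly set \<Rightarrow> ('n, 'k) mpoly list \<Rightarrow> bool" where
  "regular_seq_quot I fs \<longleftrightarrow> set fs \<subseteq> hom_max_ideal \<and>
     (\<forall>i<length fs. \<forall>g. fs ! i * g \<in> ideal_gen (I \<union> set (take i fs))
         \<longrightarrow> g \<in> ideal_gen (I \<union> set (take i fs))) \<and>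
     ideal_gen (I \<union> set fs) \<noteq> UNIV"

definition depth_quot :: "('n, 'k::field) mpoly set \<Rightarrow> enat" where
  "depth_quot I = Sup {enat (length fs) | fs. regular_seq_quot I fs}"

definition cohen_macaulay_quot :: "('n, 'k::field) mpoly set \<Rightarrow> bool" where
  "cohen_macaulay_quot I \<longleftrightarrow> depth_quot I = krull_dim_quot I"

definition wdeg :: "('n \<Rightarrow> nat) \<Rightarrow> ('n \<Rightarrow>\<^sub>0 nat) \<Rightarrow> nat" where
  "wdeg a \<alpha> = (\<Sum>i\<in>Poly_Mapping.keys \<alpha>. Poly_Mapping.lookup \<alpha> i * a i)"

text \<open>The K-algebra map S -> K[t], x_i |-> t^(a_i).\<close>
definition semigroup_map :: "('n \<Rightarrow> nat) \<Rightarrow> ('n, 'k::field) mpoly \<Rightarrow> 'k poly" where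
  "semigroup_map a f = (\<Sum>\<alpha>\<in>Poly_Mapping.keys f. monom (Poly_Mapping.lookup f \<alpha>) (wdeg a \<alpha>))"

definition toric_ideal :: "('n \<Rightarrow> nat) \<Rightarrow> ('n, 'k::field) mpoly set" where
  "toric_ideal a = {f. semigroup_map a f = 0}"

definition tangent_ideal :: "('n \<Rightarrow> nat) \<Rightarrow> ('n, 'k::field) mpoly set" where
  "tangent_ideal a = ideal_gen {initial_form f | f. f \<in> toric_ideal a \<and> f \<noteq> 0}"

definition quadratic_ideal :: "('n, 'k::field) mpoly set \<Rightarrow> bool" where
  "quadratic_ideal I \<longleftrightarrow> (\<exists>G. (\<forall>g\<in>G. homogeneous 2 g) \<and> ideal_gen G = I)"

section \<open>Degree reverse lexicographic order with x_i > x_j iff a_i > a_j\<close>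

definition drl_less :: "('n \<Rightarrow> nat) \<Rightarrow> ('n \<Rightarrow>\<^sub>0 nat) \<Rightarrow> ('n \<Rightarrow>\<^sub>0 nat) \<Rightarrow> bool" where
  "drl_less a \<alpha> \<beta> \<longleftrightarrow> mdeg \<alpha> < mdeg \<beta> \<or>
     (mdeg \<alpha> = mdeg \<beta> \<and> \<alpha> \<noteq> \<beta> \<and>
       (let i = arg_min a (\<lambda>i. Poly_Mapping.lookup \<alpha> i \<noteq> Poly_Mapping.lookup \<beta> i) in Poly_Mapping.lookup \<beta> i < Poly_Mapping.lookup \<alpha> i))"

definition lead_monom :: "('n \<Rightarrow> nat) \<Rightarrow> ('n, 'k::zero) mpoly \<Rightarrow> ('n \<Rightarrow>\<^sub>0 nat)" where
  "lead_monom a f = (THE m. m \<in> Poly_Mapping.keys f \<and> (\<forall>m'\<in>Poly_Mapping.keys f. m' \<noteq> m \<longrightarrow> drl_less a m' m))"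

definition groebner_basis :: "('n \<Rightarrow> nat) \<Rightarrow> ('n, 'k::field) mpoly set \<Rightarrow> ('n, 'k) mpoly set \<Rightarrow> bool" where
  "groebner_basis a G I \<longleftrightarrow> finite G \<and> G \<subseteq> I \<and>
     ideal_gen {Poly_Mapping.single (lead_monom a g) (1::'k) | g. g \<in> G \<and> g \<noteq> 0} =
     ideal_gen {Poly_Mapping.single (lead_monom a f) (1::'k) | f. f \<in> I \<and> f \<noteq> 0}"

end

theory Submission
  imports Defs "HOL-Library.FuncSet" "HOL-Library.Confluence"
begin

text \<open>
  The tangent ideal is spanned by monomials \<open>x\<^sup>\<alpha>\<close> whose degree is not the maximal length of a
  factorization of their weight, and by differences of monomials of equal weight and equal maximal
  degree. Hence every \<open>h \<in> H\<close> has exactly one standard monomial, and if the smallest variable \<open>x\<^sub>1\<close>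
  is regular (which Cohen--Macaulayness forces, the other variables being nilpotent), the standard
  monomials not involving \<open>x\<^sub>1\<close> correspond to the Apery set, so there are \<open>e(H)\<close> of them. Quadraticity
  makes every \<open>x\<^sub>j\<^sup>2\<close> with \<open>j > 1\<close> a leading monomial, so these standard monomials are squarefree.
  Either no further quadric \<open>x\<^sub>p x\<^sub>q\<close> is a leading monomial; then rewriting the squares is confluent,
  all squarefree monomials are standard and \<open>e(H) = 2\<^sup>n\<^sup>-\<^sup>1\<close>. Or some \<open>x\<^sub>p x\<^sub>q\<close> is one, which excludes
  \<open>2\<^sup>n\<^sup>-\<^sup>3\<close> squarefree monomials; in case of equality the initial ideal is generated by the squares
  and \<open>x\<^sub>p x\<^sub>q\<close>, i.e. by \<open>n\<close> quadrics, while the height is \<open>n - 1\<close>.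
\<close>

text \<open>In \<open>gr K[H]\<close> the classes of \<open>t^h\<close> form a basis, and a monomial
  of weight \<open>h\<close> has nonzero image exactly if its degree is the largest possible;
  otherwise \<open>t^h\<close> already lies in a higher power of the maximal ideal. Membership in
  the tangent ideal is therefore one linear condition per \<open>h\<close>, and reduction takes a
  single step, to the smallest monomial of the same weight and maximal degree. Putting
  \<open>x_1\<close> last in the reverse lexicographic order matters: a smaller monomial of equal
  degree contains at least as high a power of \<open>x_1\<close>, so standardness survives
  multiplication by \<open>x_1\<close> whenever maximality does. The obstacle is that a quadratic
  ideal may have an initial ideal with generators of higher degree. Quadraticity is thus used in one
  form: an ideal containing the reducers of degree 2 contains the tangent ideal. The test ideal is
  typically cut out by coefficient functionals. The height needs a bound on chains of primes in
  \<open>S\<close>, which comes from counting power products.\<close>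

abbreviation lookup :: "('a \<Rightarrow>\<^sub>0 'b::zero) \<Rightarrow> 'a \<Rightarrow> 'b" where
  "lookup \<equiv> Poly_Mapping.lookup"

abbreviation keys :: "('a \<Rightarrow>\<^sub>0 'b::zero) \<Rightarrow> 'a set" where
  "keys \<equiv> Poly_Mapping.keys"

abbreviation single :: "'a \<Rightarrow> 'b \<Rightarrow> 'a \<Rightarrow>\<^sub>0 'b::zero" where
  "single \<equiv> Poly_Mapping.single"

abbreviation xvar :: "'n \<Rightarrow> 'n \<Rightarrow>\<^sub>0 nat" where
  "xvar i \<equiv> Poly_Mapping.single i 1"

section \<open>Monomials\<close>

lemma mdeg_eq_sum: "mdeg \<alpha> = (\<Sum>i\<in>UNIV. lookup (\<alpha> :: 'n::finite \<Rightarrow>\<^sub>0 nat) i)"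
  unfolding mdeg_def by (rule sum.mono_neutral_left) (auto simp: in_keys_iff)

lemma wdeg_eq_sum: "wdeg a \<alpha> = (\<Sum>i\<in>UNIV. lookup (\<alpha> :: 'n::finite \<Rightarrow>\<^sub>0 nat) i * a i)"
  unfolding wdeg_def by (rule sum.mono_neutral_left) (auto simp: in_keys_iff)

lemma mdeg_add: "mdeg (\<alpha> + \<beta> :: 'n::finite \<Rightarrow>\<^sub>0 nat) = mdeg \<alpha> + mdeg \<beta>"
  by (simp add: mdeg_eq_sum lookup_add sum.distrib)

lemma wdeg_add: "wdeg a (\<alpha> + \<beta> :: 'n::finite \<Rightarrow>\<^sub>0 nat) = wdeg a \<alpha> + wdeg a \<beta>"
  by (simp add: wdeg_eq_sum lookup_add sum.distrib algebra_simps)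

lemma mdeg_zero [simp]: "mdeg 0 = 0"
  by (simp add: mdeg_def)

lemma wdeg_zero [simp]: "wdeg a 0 = 0"
  by (simp add: wdeg_def)

lemma mdeg_single [simp]: "mdeg (single i k) = k"
  by (cases "k = 0") (simp_all add: mdeg_def)

lemma wdeg_single [simp]: "wdeg a (single i k) = k * a i"
  by (cases "k = 0") (simp_all add: wdeg_def)

lemma mdeg_eq_0_iff: "mdeg (\<alpha> :: 'n::finite \<Rightarrow>\<^sub>0 nat) = 0 \<longleftrightarrow> \<alpha> = 0"
proof
  assume "mdeg \<alpha> = 0"
  then show "\<alpha> = 0"
    by (intro poly_mapping_eqI) (simp add: mdeg_eq_sum)
qed simp

lemma lookup_le_mdeg: "lookup (\<alpha> :: 'n::finite \<Rightarrow>\<^sub>0 nat) i \<le> mdeg \<alpha>"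
  unfolding mdeg_eq_sum by (rule member_le_sum) auto

lemma monom_le_decomp:
  assumes "\<And>i. lookup \<beta> i \<le> lookup (\<alpha> :: 'n \<Rightarrow>\<^sub>0 nat) i"
  obtains \<gamma> where "\<alpha> = \<beta> + \<gamma>"
proof
  show "\<alpha> = \<beta> + (\<alpha> - \<beta>)"
    by (rule poly_mapping_eqI) (use assms in \<open>simp add: lookup_add lookup_minus\<close>)
qed

lemma monom_split_var:
  assumes "lookup (\<alpha> :: 'n \<Rightarrow>\<^sub>0 nat) i \<ge> k"
  obtains \<gamma> where "\<alpha> = single i k + \<gamma>"
proof (rule monom_le_decomp)
  show "lookup (single i k) j \<le> lookup \<alpha> j" for j
    using assms by (auto simp: lookup_single when_def)
qed

lemma finite_monoms_box: "finite {\<alpha> :: 'n::finite \<Rightarrow>\<^sub>0 nat. \<forall>i. lookup \<alpha> i \<le> B}"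
  and card_monoms_box: "card {\<alpha> :: 'n::finite \<Rightarrow>\<^sub>0 nat. \<forall>i. lookup \<alpha> i \<le> B} \<le> (B + 1) ^ CARD('n)"
proof -
  let ?A = "{\<alpha> :: 'n \<Rightarrow>\<^sub>0 nat. \<forall>i. lookup \<alpha> i \<le> B}"
  let ?F = "PiE (UNIV :: 'n set) (\<lambda>_. {..B})"
  have inj: "inj_on lookup ?A"
    by (rule inj_onI) (metis poly_mapping_eqI)
  have sub: "lookup ` ?A \<subseteq> ?F"
    by auto
  have fin: "finite ?F"
    by (intro finite_PiE) auto
  have cardF: "card ?F = (B + 1) ^ CARD('n)"
    by (simp add: card_PiE)
  show "finite ?A"
    using finite_imageD[OF finite_subset[OF sub fin] inj] .
  show "card ?A \<le> (B + 1) ^ CARD('n)"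
    using card_inj_on_le[OF inj sub fin] cardF by simp
qed

lemma finite_monoms_mdeg_le: "finite {\<alpha> :: 'n::finite \<Rightarrow>\<^sub>0 nat. mdeg \<alpha> \<le> d}"
  by (rule finite_subset[OF _ finite_monoms_box[of d]])
    (auto intro: order_trans[OF lookup_le_mdeg])

lemma mdeg_1_cases:
  assumes "mdeg (\<alpha> :: 'n::finite \<Rightarrow>\<^sub>0 nat) = 1"
  obtains i where "\<alpha> = xvar i"
proof -
  have "\<alpha> \<noteq> 0"
    using assms by auto
  then obtain i where "lookup \<alpha> i \<ge> 1"
    by (metis One_nat_def Suc_leI lookup_zero neq0_conv poly_mapping_eqI)
  then obtain \<gamma> where \<gamma>: "\<alpha> = xvar i + \<gamma>"
    by (rule monom_split_var)
  then have "mdeg \<gamma> = 0"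
    using assms by (simp add: mdeg_add)
  then show thesis
    using \<gamma> that by (simp add: mdeg_eq_0_iff)
qed

lemma mdeg_2_cases:
  assumes "mdeg (\<alpha> :: 'n::finite \<Rightarrow>\<^sub>0 nat) = 2"
  obtains i j where "\<alpha> = xvar i + xvar j"
proof -
  have "\<alpha> \<noteq> 0"
    using assms by auto
  then obtain i where "lookup \<alpha> i \<ge> 1"
    by (metis One_nat_def Suc_leI lookup_zero neq0_conv poly_mapping_eqI)
  then obtain \<gamma> where \<gamma>: "\<alpha> = xvar i + \<gamma>"
    by (rule monom_split_var)
  then have "mdeg \<gamma> = 1"
    using assms by (simp add: mdeg_add)
  then show thesis
    by (rule mdeg_1_cases) (use \<gamma> that in auto)
qed

section \<open>Coefficient functionals and ideals\<close>

lemma poly_mapping_sum_singles: "(\<Sum>\<alpha>\<in>keys f. single \<alpha> (lookup f \<alpha>)) = f"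
  by (rule poly_mapping_eqI) (simp add: lookup_sum lookup_single when_def in_keys_iff)

text \<open>\<open>C\<close> may be infinite, hence the intersection with the support. Ideals are
  cut out by such functionals, with \<open>C\<close> a fiber or the set of monomials that rewrite to
  a given one.\<close>

definition coeff_sum :: "'a set \<Rightarrow> ('a \<Rightarrow>\<^sub>0 'k::comm_ring_1) \<Rightarrow> 'k" where
  "coeff_sum C f = (\<Sum>\<alpha>\<in>keys f \<inter> C. lookup f \<alpha>)"

lemma coeff_sum_superset:
  assumes "finite A" "keys f \<subseteq> A"
  shows "coeff_sum C f = (\<Sum>\<alpha>\<in>A. if \<alpha> \<in> C then lookup f \<alpha> else 0)"
proof -
  have "(\<Sum>\<alpha>\<in>A. if \<alpha> \<in> C then lookup f \<alpha> else 0) = (\<Sum>\<alpha>\<in>A \<inter> C. lookup f \<alpha>)"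
    using assms(1) by (simp add: sum.inter_restrict)
  also have "\<dots> = coeff_sum C f"
    unfolding coeff_sum_def using assms by (intro sum.mono_neutral_right) (auto simp: in_keys_iff)
  finally show ?thesis ..
qed

lemma coeff_sum_0 [simp]: "coeff_sum C 0 = 0"
  by (simp add: coeff_sum_def)

lemma coeff_sum_empty [simp]: "coeff_sum {} f = 0"
  by (simp add: coeff_sum_def)

lemma coeff_sum_add: "coeff_sum C (f + g) = coeff_sum C f + coeff_sum C g"
proof -
  have "coeff_sum C (f + g) = (\<Sum>\<alpha>\<in>keys f \<union> keys g. if \<alpha> \<in> C then lookup (f + g) \<alpha> else 0)"
    by (rule coeff_sum_superset) (simp_all add: keys_add)
  also have "\<dots> = (\<Sum>\<alpha>\<in>keys f \<union> keys g. if \<alpha> \<in> C then lookup f \<alpha> else 0) +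
      (\<Sum>\<alpha>\<in>keys f \<union> keys g. if \<alpha> \<in> C then lookup g \<alpha> else 0)"
    unfolding sum.distrib[symmetric] by (rule sum.cong) (auto simp: lookup_add)
  also have "\<dots> = coeff_sum C f + coeff_sum C g"
    by (simp add: coeff_sum_superset[symmetric])
  finally show ?thesis .
qed

lemma coeff_sum_sum: "coeff_sum C (sum F A) = (\<Sum>x\<in>A. coeff_sum C (F x))"
  by (induction A rule: infinite_finite_induct) (simp_all add: coeff_sum_add)

lemma coeff_sum_single [simp]: "coeff_sum C (single \<alpha> c) = (if \<alpha> \<in> C then c else 0)"
  by (cases "c = 0") (auto simp: coeff_sum_def)

lemma coeff_sum_uminus: "coeff_sum C (- f) = - coeff_sum C f"
  using coeff_sum_add[of C f "- f"] by (simp add: eq_neg_iff_add_eq_0 add.commute)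

lemma coeff_sum_diff: "coeff_sum C (f - g) = coeff_sum C f - coeff_sum C g"
  using coeff_sum_add[of C f "- g"] by (simp add: coeff_sum_uminus)

lemma coeff_sum_singleton: "coeff_sum {\<alpha>} f = lookup f \<alpha>"
  by (cases "\<alpha> \<in> keys f") (auto simp: coeff_sum_def in_keys_iff)

text \<open>Multiplying by a term transposes to translating the index set; a family of index sets
  closed under this translation therefore has an ideal as common kernel.\<close>

lemma coeff_sum_single_times:
  "coeff_sum C (single \<gamma> c * f) = c * coeff_sum {\<alpha>. \<gamma> + \<alpha> \<in> C} f"
proof -
  have "coeff_sum C (single \<gamma> c * f) =
      coeff_sum C (single \<gamma> c * (\<Sum>\<alpha>\<in>keys f. single \<alpha> (lookup f \<alpha>)))"
    by (simp add: poly_mapping_sum_singles)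
  also have "\<dots> = (\<Sum>\<alpha>\<in>keys f. if \<gamma> + \<alpha> \<in> C then c * lookup f \<alpha> else 0)"
    by (simp add: sum_distrib_left mult_single coeff_sum_sum)
  also have "\<dots> = c * (\<Sum>\<alpha>\<in>keys f. if \<alpha> \<in> {\<alpha>. \<gamma> + \<alpha> \<in> C} then lookup f \<alpha> else 0)"
    unfolding sum_distrib_left by (rule sum.cong) auto
  also have "\<dots> = c * coeff_sum {\<alpha>. \<gamma> + \<alpha> \<in> C} f"
    by (subst coeff_sum_superset[of "keys f" f]) auto
  finally show ?thesis .
qed

lemma lookup_single_times:
  fixes f :: "('n, 'k::comm_ring_1) mpoly"
  shows "lookup (single \<gamma> c * f) (\<gamma> + \<alpha>) = c * lookup f \<alpha>"
proof -
  have "{\<beta>. \<gamma> + \<beta> \<in> {\<gamma> + \<alpha>}} = {\<alpha>}"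
    by auto
  then show ?thesis
    using coeff_sum_single_times[of "{\<gamma> + \<alpha>}" \<gamma> c f] by (simp only: coeff_sum_singleton)
qed

lemma lookup_single_times_zero:
  assumes "\<And>\<beta>. \<gamma> + \<beta> \<noteq> \<alpha>"
  shows "lookup (single \<gamma> c * f :: ('n, 'k::comm_ring_1) mpoly) \<alpha> = 0"
proof -
  have "{\<beta>. \<gamma> + \<beta> \<in> {\<alpha>}} = {}"
    using assms by auto
  then show ?thesis
    using coeff_sum_single_times[of "{\<alpha>}" \<gamma> c f]
    by (simp only: coeff_sum_singleton coeff_sum_empty mult_zero_right)
qed

lemma lookup_mult_keys:
  "lookup (f * g) \<kappa> = (\<Sum>\<alpha>\<in>keys f. \<Sum>\<beta>\<in>keys g. if \<alpha> + \<beta> = \<kappa> then lookup f \<alpha> * lookup g \<beta> else 0)"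
proof -
  have "f * g = (\<Sum>\<alpha>\<in>keys f. single \<alpha> (lookup f \<alpha>)) * (\<Sum>\<beta>\<in>keys g. single \<beta> (lookup g \<beta>))"
    by (simp add: poly_mapping_sum_singles)
  also have "\<dots> = (\<Sum>\<alpha>\<in>keys f. \<Sum>\<beta>\<in>keys g. single (\<alpha> + \<beta>) (lookup f \<alpha> * lookup g \<beta>))"
    by (simp add: sum_product mult_single)
  finally show ?thesis
    by (simp add: lookup_sum lookup_single when_def)
qed

section \<open>Ideals and membership by monomials\<close>

lemma is_idealD:
  assumes "is_ideal I"
  shows "0 \<in> I" "\<And>x y. x \<in> I \<Longrightarrow> y \<in> I \<Longrightarrow> x + y \<in> I" "\<And>r x. x \<in> I \<Longrightarrow> r * x \<in> I"
  using assms by (auto simp: is_ideal_def)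

lemma is_ideal_mult_right: "is_ideal I \<Longrightarrow> x \<in> I \<Longrightarrow> x * r \<in> I"
  by (metis is_idealD(3) mult.commute)

lemma is_ideal_uminus: "is_ideal I \<Longrightarrow> x \<in> I \<Longrightarrow> - x \<in> I"
  using is_idealD(3)[of I x "-1"] by simp

lemma is_ideal_diff: "is_ideal I \<Longrightarrow> x \<in> I \<Longrightarrow> y \<in> I \<Longrightarrow> x - y \<in> I"
  using is_idealD(2)[of I x "- y"] is_ideal_uminus[of I y] by simp

lemma is_ideal_sum: "is_ideal I \<Longrightarrow> (\<And>x. x \<in> A \<Longrightarrow> F x \<in> I) \<Longrightarrow> sum F A \<in> I"
  by (induction A rule: infinite_finite_induct) (auto intro: is_idealD)

lemma is_ideal_ideal_gen: "is_ideal (ideal_gen G)"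
  by (auto simp: ideal_gen_def is_ideal_def)

lemma ideal_gen_superset: "G \<subseteq> ideal_gen G"
  by (auto simp: ideal_gen_def)

lemma ideal_gen_subset: "is_ideal I \<Longrightarrow> G \<subseteq> I \<Longrightarrow> ideal_gen G \<subseteq> I"
  by (auto simp: ideal_gen_def)

lemma ideal_gen_ideal: "is_ideal I \<Longrightarrow> ideal_gen I = I"
  by (meson dual_order.refl ideal_gen_subset ideal_gen_superset subset_antisym)

lemma is_ideal_monomialI:
  fixes V :: "('n, 'k::comm_ring_1) mpoly set"
  assumes "0 \<in> V" "\<And>f g. f \<in> V \<Longrightarrow> g \<in> V \<Longrightarrow> f + g \<in> V"
    and "\<And>\<gamma> c f. f \<in> V \<Longrightarrow> single \<gamma> c * f \<in> V"
  shows "is_ideal V"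
proof -
  have "r * f \<in> V" if "f \<in> V" for r f
  proof -
    have "(\<Sum>\<gamma>\<in>A. single \<gamma> (lookup r \<gamma>) * f) \<in> V" for A
      by (induction A rule: infinite_finite_induct) (use assms that in auto)
    then have "(\<Sum>\<gamma>\<in>keys r. single \<gamma> (lookup r \<gamma>)) * f \<in> V"
      by (simp add: sum_distrib_right)
    then show ?thesis
      by (simp add: poly_mapping_sum_singles)
  qed
  with assms show ?thesis
    by (auto simp: is_ideal_def)
qed

lemma in_ideal_monomialsI:
  fixes f :: "('n, 'k::comm_ring_1) mpoly"
  assumes "is_ideal I" "\<And>\<alpha>. \<alpha> \<in> keys f \<Longrightarrow> single \<alpha> 1 \<in> I"
  shows "f \<in> I"
proof -
  have "(\<Sum>\<alpha>\<in>keys f. single 0 (lookup f \<alpha>) * single \<alpha> 1) \<in> I"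
    using assms by (intro is_ideal_sum is_idealD(3)) auto
  then show ?thesis
    by (simp add: mult_single poly_mapping_sum_singles)
qed

text \<open>Running over all translates of \<open>C\<close> cuts out the largest ideal inside the
  kernel of \<open>coeff_sum C\<close>: those \<open>f\<close> whose monomial multiples all have sum
  0.\<close>

lemma coeff_sum_ideal:
  fixes C :: "('n \<Rightarrow>\<^sub>0 nat) set"
  shows "is_ideal {f :: ('n, 'k::comm_ring_1) mpoly. \<forall>\<gamma>. coeff_sum {\<alpha>. \<gamma> + \<alpha> \<in> C} f = 0}"
proof (rule is_ideal_monomialI)
  fix \<gamma> c and f :: "('n, 'k) mpoly"
  assume f: "f \<in> {f. \<forall>\<gamma>. coeff_sum {\<alpha>. \<gamma> + \<alpha> \<in> C} f = 0}"
  have "coeff_sum {\<alpha>. \<delta> + \<alpha> \<in> C} (single \<gamma> c * f) = 0" for \<delta>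
  proof -
    have "coeff_sum {\<alpha>. (\<delta> + \<gamma>) + \<alpha> \<in> C} f = 0"
      using f by blast
    then show ?thesis
      by (simp add: coeff_sum_single_times add.assoc)
  qed
  then show "single \<gamma> c * f \<in> {f. \<forall>\<gamma>. coeff_sum {\<alpha>. \<gamma> + \<alpha> \<in> C} f = 0}"
    by blast
next
  fix f g :: "('n, 'k) mpoly"
  assume "f \<in> {f. \<forall>\<gamma>. coeff_sum {\<alpha>. \<gamma> + \<alpha> \<in> C} f = 0}"
    and "g \<in> {f. \<forall>\<gamma>. coeff_sum {\<alpha>. \<gamma> + \<alpha> \<in> C} f = 0}"
  then show "f + g \<in> {f. \<forall>\<gamma>. coeff_sum {\<alpha>. \<gamma> + \<alpha> \<in> C} f = 0}"
    unfolding mem_Collect_eq coeff_sum_add by (metis add_0)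
qed simp

text \<open>The \<open>d\<close>-th power of the homogeneous maximal ideal, described by vanishing
  coefficients.\<close>

lemma low_degree_ideal:
  "is_ideal {f :: ('n::finite, 'k::comm_ring_1) mpoly. \<forall>\<alpha>. mdeg \<alpha> < d \<longrightarrow> lookup f \<alpha> = 0}"
proof (rule is_ideal_monomialI)
  fix \<gamma> c and f :: "('n, 'k) mpoly"
  assume f: "f \<in> {f. \<forall>\<alpha>. mdeg \<alpha> < d \<longrightarrow> lookup f \<alpha> = 0}"
  have "lookup (single \<gamma> c * f) \<alpha> = 0" if "mdeg \<alpha> < d" for \<alpha>
  proof (cases "\<exists>\<beta>. \<alpha> = \<gamma> + \<beta>")
    case True
    then obtain \<beta> where "\<alpha> = \<gamma> + \<beta>" ..
    then show ?thesis
      using f that by (simp add: lookup_single_times mdeg_add)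
  qed (metis lookup_single_times_zero)
  then show "single \<gamma> c * f \<in> {f. \<forall>\<alpha>. mdeg \<alpha> < d \<longrightarrow> lookup f \<alpha> = 0}"
    by simp
qed (simp_all add: lookup_add)

lemma low_degree_power:
  fixes y :: "('n::finite, 'k::comm_ring_1) mpoly"
  assumes "lookup y 0 = 0" "mdeg \<alpha> < N"
  shows "lookup (y ^ N) \<alpha> = 0"
  using assms(2)
proof (induction N arbitrary: \<alpha>)
  case (Suc N)
  have "(if \<beta> + \<gamma> = \<alpha> then lookup y \<beta> * lookup (y ^ N) \<gamma> else 0) = 0" for \<beta> \<gamma>
  proof (cases "\<beta> = 0 \<or> \<beta> + \<gamma> \<noteq> \<alpha>")
    case False
    then have "mdeg \<beta> \<noteq> 0"
      by (simp add: mdeg_eq_0_iff)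
    then have "mdeg \<gamma> < N"
      using Suc.prems False by (auto simp: mdeg_add)
    then show ?thesis
      by (simp add: Suc.IH)
  qed (auto simp: assms(1))
  then show ?case
    by (simp only: power_Suc lookup_mult_keys sum.neutral_const)
qed simp

section \<open>Homogeneous linear systems\<close>

text \<open>More unknowns than equations, by Gaussian elimination. It serves twice: for power
  products living in a box of monomials, and for generators measured against the nonstandard
  quadrics.\<close>

lemma homogeneous_system_nontrivial:
  fixes v :: "'t \<Rightarrow> 'j \<Rightarrow> 'k::field"
  assumes "finite T" "finite J" "card T < card J"
  shows "\<exists>c. (\<exists>j\<in>J. c j \<noteq> 0) \<and> (\<forall>t\<in>T. (\<Sum>j\<in>J. c j * v t j) = 0)"
  using assms
proof (induction T arbitrary: J v rule: finite_induct)
  case empty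
  then obtain j where "j \<in> J"
    by fastforce
  then show ?case
    by (intro exI[of _ "\<lambda>_. 1"]) auto
next
  case (insert t T)
  show ?case
  proof (cases "\<exists>p\<in>J. v t p \<noteq> 0")
    case False
    have "card T < card J"
      using insert by simp
    then obtain c where "\<exists>j\<in>J. c j \<noteq> 0" "\<forall>s\<in>T. (\<Sum>j\<in>J. c j * v s j) = 0"
      using insert.IH[of J v] insert.prems(1) by blast
    then show ?thesis
      using False by (intro exI[of _ c]) auto
  next
    case True
    then obtain p where p: "p \<in> J" "v t p \<noteq> 0"
      by blast
    \<comment> \<open>Coefficients of equation \<open>s\<close> after equation \<open>t\<close> has
      been solved for the unknown \<open>p\<close> and substituted.\<close>
    define w where "w s j = v s j - v t j / v t p * v s p" for s j
    have "card T < card (J - {p})"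
      using insert p by simp
    then obtain c where c: "\<exists>j\<in>J - {p}. c j \<noteq> 0" "\<forall>s\<in>T. (\<Sum>j\<in>J - {p}. c j * w s j) = 0"
      using insert.IH[of "J - {p}" w] insert.prems by auto
    define d where "d = c(p := - (\<Sum>j\<in>J - {p}. c j * v t j) / v t p)"
    have split: "(\<Sum>j\<in>J. d j * v s j) = d p * v s p + (\<Sum>j\<in>J - {p}. c j * v s j)" for s
      using insert.prems p by (subst sum.remove[of J p]) (auto simp: d_def intro!: sum.cong)
    have "(\<Sum>j\<in>J. d j * v s j) = 0" if "s \<in> insert t T" for s
    proof (cases "s = t")
      case True
      then show ?thesis
        using p by (simp add: split) (simp add: d_def)
    next
      case False
      then have "0 = (\<Sum>j\<in>J - {p}. c j * w s j)"
        using that c by auto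
      also have "\<dots> = (\<Sum>j\<in>J - {p}. c j * v s j) - (\<Sum>j\<in>J - {p}. c j * v t j) / v t p * v s p"
        by (simp add: w_def right_diff_distrib sum_subtractf sum_distrib_right sum_divide_distrib
            mult.assoc)
      also have "\<dots> = (\<Sum>j\<in>J. d j * v s j)"
        by (simp add: split) (simp add: d_def)
      finally show ?thesis ..
    qed
    moreover have "\<exists>j\<in>J. d j \<noteq> 0"
      using c by (auto simp: d_def)
    ultimately show ?thesis
      by blast
  qed
qed

section \<open>The degree reverse lexicographic order\<close>

text \<open>The minimizer in the definition is traded for an existential witness: the variable of
  smallest \<open>a\<close>-value at which the exponents differ, unique because \<open>a\<close> is
  injective. Transitivity and cancellation are read off from this form.\<close>

lemma drl_less_same_mdeg_iff:
  assumes "inj a" "mdeg \<alpha> = mdeg \<beta>"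
  shows "drl_less a \<alpha> \<beta> \<longleftrightarrow>
    (\<exists>i. lookup \<beta> i < lookup \<alpha> i \<and> (\<forall>j. a j < a i \<longrightarrow> lookup \<alpha> j = lookup \<beta> j))"
    (is "_ \<longleftrightarrow> ?R")
proof
  let ?P = "\<lambda>i. lookup \<alpha> i \<noteq> lookup \<beta> i"
  assume "drl_less a \<alpha> \<beta>"
  then have "lookup \<beta> (arg_min a ?P) < lookup \<alpha> (arg_min a ?P)"
    using assms by (simp add: drl_less_def Let_def)
  moreover have "lookup \<alpha> j = lookup \<beta> j" if "a j < a (arg_min a ?P)" for j
    using arg_min_nat_le[of ?P j a] that by force
  ultimately show ?R
    by blast
next
  let ?P = "\<lambda>i. lookup \<alpha> i \<noteq> lookup \<beta> i"
  assume ?R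
  then obtain i where i: "lookup \<beta> i < lookup \<alpha> i" "\<And>j. a j < a i \<Longrightarrow> lookup \<alpha> j = lookup \<beta> j"
    by blast
  have "arg_min a ?P = i"
    by (rule arg_min_inj_eq) (use assms i in \<open>auto intro: inj_on_subset simp: not_less[symmetric]\<close>)
  then show "drl_less a \<alpha> \<beta>"
    using assms i by (auto simp: drl_less_def Let_def)
qed

lemma drl_less_irrefl: "\<not> drl_less a \<alpha> \<alpha>"
  by (simp add: drl_less_def)

lemma drl_less_if_mdeg_less: "mdeg \<alpha> < mdeg \<beta> \<Longrightarrow> drl_less a \<alpha> \<beta>"
  by (auto simp: drl_less_def)

lemma drl_less_trans:
  assumes "inj a" "drl_less a \<alpha> \<beta>" "drl_less a \<beta> \<gamma>"
  shows "drl_less a \<alpha> \<gamma>"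
proof (cases "mdeg \<alpha> = mdeg \<beta> \<and> mdeg \<beta> = mdeg \<gamma>")
  case True
  obtain i where i: "lookup \<beta> i < lookup \<alpha> i" "\<And>j. a j < a i \<Longrightarrow> lookup \<alpha> j = lookup \<beta> j"
    using drl_less_same_mdeg_iff[OF assms(1), of \<alpha> \<beta>] assms True by auto
  obtain k where k: "lookup \<gamma> k < lookup \<beta> k" "\<And>j. a j < a k \<Longrightarrow> lookup \<beta> j = lookup \<gamma> j"
    using drl_less_same_mdeg_iff[OF assms(1), of \<beta> \<gamma>] assms True by auto
  have "\<exists>l. lookup \<gamma> l < lookup \<alpha> l \<and> (\<forall>j. a j < a l \<longrightarrow> lookup \<alpha> j = lookup \<gamma> j)"
  proof (cases "a i" "a k" rule: linorder_cases)
    case less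
    then show ?thesis
      using i k by (intro exI[of _ i]) auto
  next
    case equal
    then have "i = k"
      using assms(1) by (simp add: inj_eq)
    then show ?thesis
      using i k by (intro exI[of _ i]) auto
  next
    case greater
    then show ?thesis
      using i k by (intro exI[of _ k]) auto
  qed
  then show ?thesis
    using drl_less_same_mdeg_iff[OF assms(1), of \<alpha> \<gamma>] True by auto
next
  case False
  then show ?thesis
    using assms(2,3) by (intro drl_less_if_mdeg_less) (auto simp: drl_less_def)
qed

lemma drl_less_total:
  assumes "inj a" "\<alpha> \<noteq> \<beta>"
  shows "drl_less a \<alpha> \<beta> \<or> drl_less a \<beta> \<alpha>"
proof (cases "mdeg \<alpha> = mdeg \<beta>")
  case True
  let ?P = "\<lambda>i. lookup \<alpha> i \<noteq> lookup \<beta> i"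
  obtain k where k: "?P k"
    using assms(2) by (meson poly_mapping_eqI)
  have "?P (arg_min a ?P)"
    using arg_min_natI[of ?P, OF k] .
  moreover have "lookup \<alpha> j = lookup \<beta> j" if "a j < a (arg_min a ?P)" for j
    using arg_min_nat_le[of ?P j a] that by force
  ultimately have "(\<exists>i. lookup \<beta> i < lookup \<alpha> i \<and> (\<forall>j. a j < a i \<longrightarrow> lookup \<alpha> j = lookup \<beta> j)) \<or>
      (\<exists>i. lookup \<alpha> i < lookup \<beta> i \<and> (\<forall>j. a j < a i \<longrightarrow> lookup \<beta> j = lookup \<alpha> j))"
    by (cases "lookup \<beta> (arg_min a ?P) < lookup \<alpha> (arg_min a ?P)")
      (auto intro!: exI[of _ "arg_min a ?P"])
  then show ?thesis
    using drl_less_same_mdeg_iff[OF assms(1), of \<alpha> \<beta>] drl_less_same_mdeg_iff[OF assms(1), of \<beta> \<alpha>] True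
    by simp
next
  case False
  then show ?thesis
    by (auto simp: drl_less_def)
qed

lemma drl_less_asym: "inj a \<Longrightarrow> drl_less a \<alpha> \<beta> \<Longrightarrow> \<not> drl_less a \<beta> \<alpha>"
  using drl_less_trans drl_less_irrefl by metis

lemma drl_less_add_left_iff:
  assumes "inj a"
  shows "drl_less a (\<gamma> + \<alpha>) (\<gamma> + \<beta> :: 'n::finite \<Rightarrow>\<^sub>0 nat) \<longleftrightarrow> drl_less a \<alpha> \<beta>"
proof (cases "mdeg \<alpha> = mdeg \<beta>")
  case True
  then show ?thesis
    using drl_less_same_mdeg_iff[OF assms, of \<alpha> \<beta>]
      drl_less_same_mdeg_iff[OF assms, of "\<gamma> + \<alpha>" "\<gamma> + \<beta>"]
    by (simp add: mdeg_add lookup_add)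
qed (simp add: drl_less_def mdeg_add)

lemma drl_max_exists:
  assumes "inj a" "finite A" "A \<noteq> {}"
  obtains m where "m \<in> A" "\<And>m'. m' \<in> A \<Longrightarrow> m' \<noteq> m \<Longrightarrow> drl_less a m' m"
proof -
  have "\<exists>m\<in>A. \<forall>m'\<in>A. m' \<noteq> m \<longrightarrow> drl_less a m' m"
    using assms(2,3)
  proof (induction A rule: finite_ne_induct)
    case (insert x F)
    then obtain m where m: "m \<in> F" "\<forall>m'\<in>F. m' \<noteq> m \<longrightarrow> drl_less a m' m"
      by blast
    show ?case
    proof (cases "drl_less a x m")
      case True
      then show ?thesis
        using m by auto
    next
      case False
      then have "drl_less a m x"
        using drl_less_total[OF assms(1), of x m] m insert.hyps by auto
      then show ?thesis
        using m drl_less_trans[OF assms(1)] by (metis insert_iff)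
    qed
  qed auto
  then show thesis
    using that by blast
qed

lemma drl_min_exists:
  assumes "inj a" "finite A" "A \<noteq> {}"
  obtains m where "m \<in> A" "\<And>m'. m' \<in> A \<Longrightarrow> m' \<noteq> m \<Longrightarrow> drl_less a m m'"
proof -
  have "\<exists>m\<in>A. \<forall>m'\<in>A. m' \<noteq> m \<longrightarrow> drl_less a m m'"
    using assms(2,3)
  proof (induction A rule: finite_ne_induct)
    case (insert x F)
    then obtain m where m: "m \<in> F" "\<forall>m'\<in>F. m' \<noteq> m \<longrightarrow> drl_less a m m'"
      by blast
    show ?case
    proof (cases "drl_less a m x")
      case True
      then show ?thesis
        using m by auto
    next
      case False
      then have "drl_less a x m"
        using drl_less_total[OF assms(1), of x m] m insert.hyps by auto
      then show ?thesis
        using m drl_less_trans[OF assms(1)] by (metis insert_iff)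
    qed
  qed auto
  then show thesis
    using that by blast
qed

lemma lead_monom_eqI:
  assumes "inj a" "m \<in> keys f" "\<And>m'. m' \<in> keys f \<Longrightarrow> m' \<noteq> m \<Longrightarrow> drl_less a m' m"
  shows "lead_monom a f = m"
  unfolding lead_monom_def
proof (rule the_equality)
  fix n
  assume "n \<in> keys f \<and> (\<forall>m'\<in>keys f. m' \<noteq> n \<longrightarrow> drl_less a m' n)"
  then show "n = m"
    using assms drl_less_asym by metis
qed (use assms in blast)

lemma lead_monom_max:
  assumes "inj a" "f \<noteq> 0"
  shows "lead_monom a f \<in> keys f"
    and "m' \<in> keys f \<Longrightarrow> m' \<noteq> lead_monom a f \<Longrightarrow> drl_less a m' (lead_monom a f)"
proof -
  have "keys f \<noteq> {}"
    using assms(2) by simp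
  then obtain m where m: "m \<in> keys f" "\<And>m'. m' \<in> keys f \<Longrightarrow> m' \<noteq> m \<Longrightarrow> drl_less a m' m"
    using drl_max_exists[OF assms(1) finite_keys] by metis
  then have "lead_monom a f = m"
    using lead_monom_eqI[OF assms(1)] by blast
  with m show "lead_monom a f \<in> keys f"
    and "m' \<in> keys f \<Longrightarrow> m' \<noteq> lead_monom a f \<Longrightarrow> drl_less a m' (lead_monom a f)"
    by auto
qed

section \<open>Prime ideals and height\<close>

text \<open>The ideal generated by the variables in \<open>W\<close>, encoded by supports:
  \<open>f\<close> has no term free of \<open>W\<close>. Membership becomes a statement on
  coefficients.\<close>

definition var_ideal :: "'n set \<Rightarrow> ('n, 'k::comm_ring_1) mpoly set" where
  "var_ideal W = {f. \<forall>\<alpha>. (\<forall>w\<in>W. lookup \<alpha> w = 0) \<longrightarrow> lookup f \<alpha> = 0}"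

lemma is_ideal_var_ideal: "is_ideal (var_ideal W :: ('n, 'k::comm_ring_1) mpoly set)"
proof (rule is_ideal_monomialI)
  fix \<gamma> c and f :: "('n, 'k) mpoly"
  assume f: "f \<in> var_ideal W"
  have "lookup (single \<gamma> c * f) \<alpha> = 0" if "\<forall>w\<in>W. lookup \<alpha> w = 0" for \<alpha>
  proof (cases "\<exists>\<beta>. \<alpha> = \<gamma> + \<beta>")
    case True
    then obtain \<beta> where "\<alpha> = \<gamma> + \<beta>" ..
    then show ?thesis
      using f that by (simp add: lookup_single_times lookup_add var_ideal_def)
  qed (metis lookup_single_times_zero)
  then show "single \<gamma> c * f \<in> var_ideal W"
    by (simp add: var_ideal_def)
qed (simp_all add: lookup_add var_ideal_def)

lemma monomial_in_var_ideal_iff: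
  "(single \<alpha> 1 :: ('n, 'k::comm_ring_1) mpoly) \<in> var_ideal W \<longleftrightarrow> (\<exists>w\<in>W. lookup \<alpha> w \<noteq> 0)"
  by (auto simp: var_ideal_def lookup_single when_def)

text \<open>Among the terms free of \<open>W\<close>, the leading ones of \<open>f\<close> and
  \<open>g\<close> multiply to a monomial that arises in no other way, so it cannot cancel in
  \<open>f * g\<close>.\<close>

lemma prime_var_ideal: "prime_ideal (var_ideal W :: ('n::finite, 'k::field) mpoly set)"
  unfolding prime_ideal_def
proof (intro conjI allI impI is_ideal_var_ideal)
  have "(1 :: ('n, 'k) mpoly) \<notin> var_ideal W"
    using monomial_in_var_ideal_iff[of 0 W, where 'k = 'k] by simp
  then show "(var_ideal W :: ('n, 'k) mpoly set) \<noteq> UNIV"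
    by blast
next
  fix f g :: "('n, 'k) mpoly"
  assume fg: "f * g \<in> var_ideal W"
  let ?Z = "{\<alpha>. \<forall>w\<in>W. lookup \<alpha> w = 0}"
  \<comment> \<open>Any injective weight gives a monomial order; it merely serves to pick leading
    terms.\<close>
  obtain b :: "'n \<Rightarrow> nat" where b: "inj b"
    using finite_imp_inj_to_nat_seg[of "UNIV :: 'n set"] by auto
  show "f \<in> var_ideal W \<or> g \<in> var_ideal W"
  proof (rule ccontr)
    assume "\<not> ?thesis"
    then have ne: "keys f \<inter> ?Z \<noteq> {}" "keys g \<inter> ?Z \<noteq> {}"
      by (auto simp: var_ideal_def in_keys_iff)
    have fin: "finite (keys f \<inter> ?Z)" "finite (keys g \<inter> ?Z)"
      by simp_all
    obtain \<mu> where \<mu>: "\<mu> \<in> keys f \<inter> ?Z"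
      "\<And>m'. m' \<in> keys f \<inter> ?Z \<Longrightarrow> m' \<noteq> \<mu> \<Longrightarrow> drl_less b m' \<mu>"
      by (rule drl_max_exists[OF b fin(1) ne(1)]) blast
    obtain \<nu> where \<nu>: "\<nu> \<in> keys g \<inter> ?Z"
      "\<And>m'. m' \<in> keys g \<inter> ?Z \<Longrightarrow> m' \<noteq> \<nu> \<Longrightarrow> drl_less b m' \<nu>"
      by (rule drl_max_exists[OF b fin(2) ne(2)]) blast
    \<comment> \<open>Exponents on \<open>W\<close> are nonnegative and add up to 0, so both factors
      avoid \<open>W\<close>; a pair other than \<open>\<mu>\<close>, \<open>\<nu>\<close> would
      then be smaller in both components, hence in the product.\<close>
    have *: "\<alpha> = \<mu> \<and> \<beta> = \<nu>" if "\<alpha> \<in> keys f" "\<beta> \<in> keys g" "\<alpha> + \<beta> = \<mu> + \<nu>" for \<alpha> \<beta>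
    proof -
      have "lookup \<alpha> w = 0 \<and> lookup \<beta> w = 0" if "w \<in> W" for w
      proof -
        have "lookup \<alpha> w + lookup \<beta> w = lookup \<mu> w + lookup \<nu> w"
          using \<open>\<alpha> + \<beta> = \<mu> + \<nu>\<close> by (metis lookup_add)
        then show ?thesis
          using \<mu>(1) \<nu>(1) that by auto
      qed
      then have Z: "\<alpha> \<in> keys f \<inter> ?Z" "\<beta> \<in> keys g \<inter> ?Z"
        using that by auto
      show ?thesis
      proof (rule ccontr)
        assume neq: "\<not> ?thesis"
        then have "\<alpha> \<noteq> \<mu>" "\<beta> \<noteq> \<nu>"
          using that(3) by auto
        then have "drl_less b \<alpha> \<mu>" "drl_less b \<beta> \<nu>"
          using \<mu>(2) \<nu>(2) Z by auto
        then have "drl_less b (\<beta> + \<alpha>) (\<beta> + \<mu>)" "drl_less b (\<mu> + \<beta>) (\<mu> + \<nu>)"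
          using drl_less_add_left_iff[OF b] by auto
        then have "drl_less b (\<mu> + \<nu>) (\<mu> + \<nu>)"
          using drl_less_trans[OF b] that(3) by (metis add.commute)
        then show False
          by (simp add: drl_less_irrefl)
      qed
    qed
    have "lookup (f * g) (\<mu> + \<nu>) =
      (\<Sum>\<alpha>\<in>keys f. \<Sum>\<beta>\<in>keys g. if \<alpha> = \<mu> \<and> \<beta> = \<nu> then lookup f \<alpha> * lookup g \<beta> else 0)"
      unfolding lookup_mult_keys using * by (intro sum.cong) auto
    also have "\<dots> = (\<Sum>\<alpha>\<in>keys f. if \<alpha> = \<mu> then lookup f \<alpha> * lookup g \<nu> else 0)"
      using \<nu>(1) by (intro sum.cong) (auto simp: sum.delta)
    also have "\<dots> = lookup f \<mu> * lookup g \<nu>"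
      using \<mu>(1) by (simp add: sum.delta)
    finally have "lookup (f * g) (\<mu> + \<nu>) \<noteq> 0"
      using \<mu>(1) \<nu>(1) by (simp add: in_keys_iff)
    moreover have "\<forall>w\<in>W. lookup (\<mu> + \<nu>) w = 0"
      using \<mu>(1) \<nu>(1) by (simp add: lookup_add)
    ultimately show False
      using fg by (auto simp: var_ideal_def)
  qed
qed

lemma var_ideal_mono: "W \<subseteq> W' \<Longrightarrow> var_ideal W \<subseteq> var_ideal W'"
  by (auto simp: var_ideal_def)

lemma var_ideal_strict_mono:
  assumes "W \<subset> W'"
  shows "(var_ideal W :: ('n, 'k::comm_ring_1) mpoly set) \<subset> var_ideal W'"
proof -
  obtain w where w: "w \<in> W'" "w \<notin> W"
    using assms by blast
  have "(single (xvar w) 1 :: ('n, 'k) mpoly) \<in> var_ideal W'"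
    using w by (auto simp: monomial_in_var_ideal_iff intro!: bexI[of _ w])
  moreover have "(single (xvar w) 1 :: ('n, 'k) mpoly) \<notin> var_ideal W"
    using w by (auto simp: monomial_in_var_ideal_iff lookup_single when_def)
  ultimately show ?thesis
    using var_ideal_mono[of W W'] assms by blast
qed

lemma prime_idealD:
  assumes "prime_ideal P"
  shows "is_ideal P" "1 \<notin> P" "\<And>x y. x * y \<in> P \<Longrightarrow> x \<in> P \<or> y \<in> P"
proof -
  show "is_ideal P" "\<And>x y. x * y \<in> P \<Longrightarrow> x \<in> P \<or> y \<in> P"
    using assms by (auto simp: prime_ideal_def)
  show "1 \<notin> P"
  proof
    assume "1 \<in> P"
    then have "x * 1 \<in> P" for x
      using \<open>is_ideal P\<close> is_idealD(3) by blast
    then show False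
      using assms by (auto simp: prime_ideal_def)
  qed
qed

lemma prime_ideal_power: "prime_ideal P \<Longrightarrow> x ^ k \<in> P \<Longrightarrow> x \<in> P"
  by (induction k) (auto dest: prime_idealD)

text \<open>Peel off the lowest power of the first element, reduce modulo it, and move one step up
  the chain of primes.\<close>
lemma polynomial_relation_not_in_prime:
  fixes f :: "nat \<Rightarrow> 'a::comm_ring_1" and P :: "nat \<Rightarrow> 'a set"
  assumes prime: "\<And>i. i \<le> N \<Longrightarrow> prime_ideal (P i)"
    and sub: "\<And>i. i < N \<Longrightarrow> P i \<subseteq> P (Suc i)"
    and f: "\<And>i. i < N \<Longrightarrow> f i \<in> P (Suc i) - P i"
    and ext: "E0 \<subseteq> extensional {..<N}"
    and c: "\<And>\<nu>. \<nu> \<in> E0 \<Longrightarrow> c \<nu> \<notin> P N"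
    and E0: "finite E0" "E0 \<noteq> {}"
  shows "(\<Sum>\<nu>\<in>E0. c \<nu> * (\<Prod>i<N. f i ^ \<nu> i)) \<notin> P 0"
proof -
  \<comment> \<open>Descending induction on \<open>j\<close>: the exponents below \<open>j\<close>
    are already fixed on \<open>E\<close>, and the factors still present are \<open>f j\<close>,
    ..., \<open>f (N - 1)\<close>. At \<open>j = N\<close> extensionality leaves one multi-index,
    whose coefficient lies outside \<open>P N\<close>.\<close>
  have "\<forall>E. E \<subseteq> E0 \<and> E \<noteq> {} \<and> (\<forall>\<nu>\<in>E. \<forall>\<mu>\<in>E. \<forall>i<j. \<nu> i = \<mu> i) \<longrightarrow>
      (\<Sum>\<nu>\<in>E. c \<nu> * (\<Prod>i\<in>{j..<N}. f i ^ \<nu> i)) \<notin> P j" if "j \<le> N" for j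
    using that
  proof (induction rule: inc_induct)
    case base
    show ?case
    proof (intro allI impI)
      fix E
      assume E: "E \<subseteq> E0 \<and> E \<noteq> {} \<and> (\<forall>\<nu>\<in>E. \<forall>\<mu>\<in>E. \<forall>i<N. \<nu> i = \<mu> i)"
      then obtain \<nu> where \<nu>: "\<nu> \<in> E"
        by blast
      have "\<mu> = \<nu>" if "\<mu> \<in> E" for \<mu>
        by (rule extensionalityI[of _ "{..<N}"]) (use E ext \<nu> that in auto)
      then have "E = {\<nu>}"
        using \<nu> by blast
      then show "(\<Sum>\<nu>\<in>E. c \<nu> * (\<Prod>i\<in>{N..<N}. f i ^ \<nu> i)) \<notin> P N"
        using c E by auto
    qed
  next
    case (step j)
    show ?case
    proof (intro allI impI notI)
      fix E
      assume E: "E \<subseteq> E0 \<and> E \<noteq> {} \<and> (\<forall>\<nu>\<in>E. \<forall>\<mu>\<in>E. \<forall>i<j. \<nu> i = \<mu> i)"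
      assume mem: "(\<Sum>\<nu>\<in>E. c \<nu> * (\<Prod>i\<in>{j..<N}. f i ^ \<nu> i)) \<in> P j"
      have prime_j: "prime_ideal (P j)"
        using prime step.hyps by simp
      have finE: "finite E"
        using E E0 finite_subset by blast
      define m where "m = Min ((\<lambda>\<nu>. \<nu> j) ` E)"
      have m_le: "m \<le> \<nu> j" if "\<nu> \<in> E" for \<nu>
        unfolding m_def using finE that by (intro Min_le) auto
      have "m \<in> (\<lambda>\<nu>. \<nu> j) ` E"
        unfolding m_def using finE E by (intro Min_in) auto
      define E' where "E' = {\<nu>\<in>E. \<nu> j = m}"
      have E'_ne: "E' \<noteq> {}"
        using \<open>m \<in> _\<close> by (auto simp: E'_def)
      define T where "T \<nu> = c \<nu> * (\<Prod>i\<in>{Suc j..<N}. f i ^ \<nu> i)" for \<nu>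
      define R where "R = (\<Sum>\<nu>\<in>E - E'. f j ^ (\<nu> j - m - 1) * T \<nu>)"
      have T: "c \<nu> * (\<Prod>i\<in>{j..<N}. f i ^ \<nu> i) = f j ^ \<nu> j * T \<nu>" for \<nu>
        using step.hyps by (simp add: T_def prod.atLeast_Suc_lessThan mult_ac)
      have "(\<Sum>\<nu>\<in>E. c \<nu> * (\<Prod>i\<in>{j..<N}. f i ^ \<nu> i)) =
          (\<Sum>\<nu>\<in>E'. f j ^ \<nu> j * T \<nu>) + (\<Sum>\<nu>\<in>E - E'. f j ^ \<nu> j * T \<nu>)"
        unfolding T using finE by (subst sum.subset_diff[of E' E]) (auto simp: E'_def add.commute)
      also have "(\<Sum>\<nu>\<in>E'. f j ^ \<nu> j * T \<nu>) = f j ^ m * (\<Sum>\<nu>\<in>E'. T \<nu>)"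
        unfolding sum_distrib_left by (rule sum.cong) (auto simp: E'_def)
      also have "(\<Sum>\<nu>\<in>E - E'. f j ^ \<nu> j * T \<nu>) = f j ^ m * (f j * R)"
        unfolding R_def sum_distrib_left
      proof (rule sum.cong)
        fix \<nu>
        assume "\<nu> \<in> E - E'"
        then have "\<nu> j > m"
          using m_le[of \<nu>] by (auto simp: E'_def)
        then have "f j ^ \<nu> j = f j ^ m * (f j * f j ^ (\<nu> j - m - 1))"
          by (simp flip: power_Suc power_add)
        then show "f j ^ \<nu> j * T \<nu> = f j ^ m * (f j * (f j ^ (\<nu> j - m - 1) * T \<nu>))"
          by (simp add: mult_ac)
      qed simp
      also have "f j ^ m * (\<Sum>\<nu>\<in>E'. T \<nu>) + f j ^ m * (f j * R) = f j ^ m * ((\<Sum>\<nu>\<in>E'. T \<nu>) + f j * R)"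
        by (simp add: algebra_simps)
      finally have "f j ^ m * ((\<Sum>\<nu>\<in>E'. T \<nu>) + f j * R) \<in> P j"
        using mem by simp
      moreover have "f j ^ m \<notin> P j"
        using prime_ideal_power[OF prime_j, of "f j" m] f[OF \<open>j < N\<close>] by blast
      ultimately have sum_in: "(\<Sum>\<nu>\<in>E'. T \<nu>) + f j * R \<in> P (Suc j)"
        using prime_idealD(3)[OF prime_j] sub[OF \<open>j < N\<close>] by blast
      have ideal: "is_ideal (P (Suc j))"
        using prime step.hyps by (simp add: prime_ideal_def)
      have "f j * R \<in> P (Suc j)"
        using f[OF \<open>j < N\<close>] by (intro is_ideal_mult_right[OF ideal]) auto
      then have "(\<Sum>\<nu>\<in>E'. T \<nu>) \<in> P (Suc j)"
        using is_ideal_diff[OF ideal sum_in, of "f j * R"] by simp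
      moreover have "\<forall>\<nu>\<in>E'. \<forall>\<mu>\<in>E'. \<forall>i<Suc j. \<nu> i = \<mu> i"
      proof (intro ballI allI impI)
        fix \<nu> \<mu> i
        assume "\<nu> \<in> E'" "\<mu> \<in> E'" "i < Suc j"
        then show "\<nu> i = \<mu> i"
          using E by (cases "i = j") (auto simp: E'_def)
      qed
      moreover have "E' \<subseteq> E0"
        using E by (auto simp: E'_def)
      ultimately show False
        using step.IH[THEN spec, THEN mp, OF conjI, OF _ conjI, of E'] E'_ne by (simp add: T_def)
    qed
  qed
  from this[of 0] show ?thesis
    using E0 by (auto simp: atLeast0LessThan)
qed

section \<open>Algebraic dependence by counting, and bounds on heights\<close>

definition exponents_le :: "nat \<Rightarrow> ('n, 'k::comm_ring_1) mpoly \<Rightarrow> bool" where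
  "exponents_le e f \<longleftrightarrow> (\<forall>\<alpha>\<in>keys f. \<forall>x. lookup \<alpha> x \<le> e)"

lemma exponents_le_mono: "exponents_le e f \<Longrightarrow> e \<le> e' \<Longrightarrow> exponents_le e' f"
  unfolding exponents_le_def by (meson order_trans)

lemma exponents_le_one: "exponents_le e (1 :: ('n, 'k::comm_ring_1) mpoly)"
  by (auto simp: exponents_le_def in_keys_iff lookup_one when_def split: if_splits)

lemma exponents_le_mult:
  assumes "exponents_le e f" "exponents_le e' g"
  shows "exponents_le (e + e') (f * g)"
  unfolding exponents_le_def
proof (intro ballI allI)
  fix \<alpha> x
  assume "\<alpha> \<in> keys (f * g)"
  then obtain \<beta> \<gamma> where "\<alpha> = \<beta> + \<gamma>" "\<beta> \<in> keys f" "\<gamma> \<in> keys g"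
    using keys_mult[of f g] by blast
  then show "lookup \<alpha> x \<le> e + e'"
    using assms by (auto simp: exponents_le_def lookup_add intro: add_mono)
qed

lemma exponents_le_power: "exponents_le e f \<Longrightarrow> exponents_le (k * e) (f ^ k)"
  by (induction k) (auto simp: exponents_le_one intro: exponents_le_mult)

lemma exponents_le_prod:
  "(\<And>i. i \<in> A \<Longrightarrow> exponents_le (e i) (F i)) \<Longrightarrow> exponents_le (\<Sum>i\<in>A. e i) (\<Prod>i\<in>A. F i)"
  by (induction A rule: infinite_finite_induct) (auto simp: exponents_le_one intro: exponents_le_mult)

text \<open>Counting: there are \<open>D ^ (n + 1)\<close> power products with exponents below \<open>D\<close>, but they live in
  a space whose dimension grows only like \<open>D ^ n\<close>.\<close>
lemma algebraically_dependent:
  fixes f :: "nat \<Rightarrow> ('n::finite, 'k::field) mpoly"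
  defines "N \<equiv> Suc CARD('n)"
  obtains E c where "finite E" "E \<noteq> {}" "E \<subseteq> extensional {..<N}" "\<And>\<nu>. \<nu> \<in> E \<Longrightarrow> c \<nu> \<noteq> 0"
    "(\<Sum>\<nu>\<in>E. single 0 (c \<nu>) * (\<Prod>i<N. f i ^ \<nu> i)) = 0"
proof -
  define d where "d = (\<Sum>i<N. \<Sum>\<alpha>\<in>keys (f i). mdeg \<alpha>)"
  have d: "exponents_le d (f i)" if "i < N" for i
    unfolding exponents_le_def
  proof (intro ballI allI)
    fix \<alpha> x
    assume "\<alpha> \<in> keys (f i)"
    have "lookup \<alpha> x \<le> mdeg \<alpha>"
      by (rule lookup_le_mdeg)
    also have "\<dots> \<le> (\<Sum>\<alpha>\<in>keys (f i). mdeg \<alpha>)"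
      using \<open>\<alpha> \<in> keys (f i)\<close> by (intro member_le_sum) auto
    also have "\<dots> \<le> d"
      unfolding d_def using that by (intro member_le_sum[of i "{..<N}"]) auto
    finally show "lookup \<alpha> x \<le> d" .
  qed
  \<comment> \<open>\<open>d\<close> bounds all exponents in the \<open>f i\<close>, so products
    with exponents below \<open>D\<close> stay in a box of side at most \<open>b * D\<close>. The
    choice \<open>D > b ^ n\<close>, with \<open>n\<close> the number of variables, gives
    \<open>(b * D) ^ n < D ^ (n + 1)\<close>.\<close>
  define b where "b = N * d + 1"
  define D where "D = Suc (b ^ CARD('n))"
  define J where "J = PiE {..<N} (\<lambda>_. {..<D})"
  define F where "F \<nu> = (\<Prod>i<N. f i ^ \<nu> i)" for \<nu>
  define T where "T = {\<alpha> :: 'n \<Rightarrow>\<^sub>0 nat. \<forall>x. lookup \<alpha> x \<le> N * (D * d)}"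
  have finJ: "finite J"
    unfolding J_def by (intro finite_PiE) auto
  have cardJ: "card J = D ^ N"
    by (simp add: J_def card_PiE)
  have finT: "finite T"
    unfolding T_def by (rule finite_monoms_box)
  have "card T \<le> (N * (D * d) + 1) ^ CARD('n)"
    unfolding T_def by (rule card_monoms_box)
  also have "\<dots> \<le> (b * D) ^ CARD('n)"
  proof (rule power_mono)
    have "1 \<le> D"
      by (simp add: D_def)
    then show "N * (D * d) + 1 \<le> b * D"
      by (simp add: b_def algebra_simps)
  qed simp
  also have "\<dots> = b ^ CARD('n) * D ^ CARD('n)"
    by (rule power_mult_distrib)
  also have "\<dots> < D * D ^ CARD('n)"
    by (rule mult_strict_right_mono) (simp_all add: D_def)
  finally have "card T < card J"
    by (simp add: cardJ N_def)
  then obtain c where c: "\<exists>\<nu>\<in>J. c \<nu> \<noteq> 0" "\<forall>\<alpha>\<in>T. (\<Sum>\<nu>\<in>J. c \<nu> * lookup (F \<nu>) \<alpha>) = 0"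
    using homogeneous_system_nontrivial[OF finT finJ, of "\<lambda>\<alpha> \<nu>. lookup (F \<nu>) \<alpha>"] by blast
  have F_T: "lookup (F \<nu>) \<alpha> = 0" if "\<nu> \<in> J" "\<alpha> \<notin> T" for \<nu> \<alpha>
  proof -
    have "exponents_le (\<Sum>i<N. \<nu> i * d) (F \<nu>)"
      unfolding F_def using d by (intro exponents_le_prod exponents_le_power) auto
    moreover have "(\<Sum>i<N. \<nu> i * d) \<le> (\<Sum>i<N. D * d)"
      using that(1) by (intro sum_mono mult_right_mono) (auto simp: J_def dest!: PiE_mem)
    ultimately have "exponents_le (N * (D * d)) (F \<nu>)"
      by (rule exponents_le_mono[OF _ order_trans]) simp
    then show ?thesis
      using that(2) by (auto simp: exponents_le_def T_def in_keys_iff)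
  qed
  \<comment> \<open>Discarding zero coefficients leaves units, which lie in no prime.\<close>
  define E where "E = {\<nu>\<in>J. c \<nu> \<noteq> 0}"
  have "(\<Sum>\<nu>\<in>E. single 0 (c \<nu>) * F \<nu>) = 0"
  proof (rule poly_mapping_eqI)
    fix \<alpha>
    have "lookup (single 0 (c \<nu>) * F \<nu>) \<alpha> = c \<nu> * lookup (F \<nu>) \<alpha>" for \<nu>
      using lookup_single_times[of 0 "c \<nu>" "F \<nu>" \<alpha>] by simp
    then have "lookup (\<Sum>\<nu>\<in>E. single 0 (c \<nu>) * F \<nu>) \<alpha> = (\<Sum>\<nu>\<in>E. c \<nu> * lookup (F \<nu>) \<alpha>)"
      by (simp add: lookup_sum)
    also have "\<dots> = (\<Sum>\<nu>\<in>J. c \<nu> * lookup (F \<nu>) \<alpha>)"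
      unfolding E_def using finJ by (intro sum.mono_neutral_left) auto
    also have "\<dots> = 0"
      using c(2) F_T by (cases "\<alpha> \<in> T") auto
    finally show "lookup (\<Sum>\<nu>\<in>E. single 0 (c \<nu>) * F \<nu>) \<alpha> = lookup 0 \<alpha>"
      by simp
  qed
  moreover have "finite E"
    using finJ by (simp add: E_def)
  moreover have "E \<subseteq> extensional {..<N}"
    by (auto simp: E_def J_def PiE_def)
  ultimately show thesis
    using c(1) by (intro that[of E c]) (auto simp: E_def F_def)
qed

text \<open>One element is chosen from each of \<open>n + 1\<close> steps of the chain. These
  satisfy a nontrivial relation over the field, whose coefficients are units and avoid all primes;
  but then the value of the relation lies outside \<open>P 0\<close> and cannot be 0.\<close>

lemma prime_chain_length_le:
  fixes P :: "nat \<Rightarrow> ('n::finite, 'k::field) mpoly set"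
  assumes prime: "\<And>i. i \<le> k \<Longrightarrow> prime_ideal (P i)"
    and strict: "\<And>i. i < k \<Longrightarrow> P i \<subset> P (Suc i)"
  shows "k \<le> CARD('n)"
proof (rule ccontr)
  let ?N = "Suc CARD('n)"
  assume "\<not> k \<le> CARD('n)"
  then have k: "?N \<le> k"
    by simp
  have "\<exists>g. g \<in> P (Suc i) - P i" if "i < ?N" for i
    using strict[of i] that k by auto
  then obtain f where f: "\<And>i. i < ?N \<Longrightarrow> f i \<in> P (Suc i) - P i"
    by metis
  obtain E c where E: "finite E" "E \<noteq> {}" "E \<subseteq> extensional {..<?N}" "\<And>\<nu>. \<nu> \<in> E \<Longrightarrow> c \<nu> \<noteq> 0"
    "(\<Sum>\<nu>\<in>E. single 0 (c \<nu>) * (\<Prod>i<?N. f i ^ \<nu> i)) = 0"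
    by (rule algebraically_dependent[of f]) blast
  have "(\<Sum>\<nu>\<in>E. single 0 (c \<nu>) * (\<Prod>i<?N. f i ^ \<nu> i)) \<notin> P 0"
  proof (rule polynomial_relation_not_in_prime)
    fix \<nu>
    assume "\<nu> \<in> E"
    have prime_N: "prime_ideal (P ?N)"
      using prime k by blast
    show "single 0 (c \<nu>) \<notin> P ?N"
    proof
      assume "single 0 (c \<nu>) \<in> P ?N"
      then have "single 0 (inverse (c \<nu>)) * single 0 (c \<nu>) \<in> P ?N"
        using prime_idealD(1)[OF prime_N] is_idealD(3) by blast
      then show False
        using prime_idealD(2)[OF prime_N] E(4)[OF \<open>\<nu> \<in> E\<close>] by (simp add: mult_single)
    qed
  next
    fix i
    assume "i < ?N"
    then have "i < k"
      using k by simp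
    then show "P i \<subseteq> P (Suc i)"
      using strict by blast
  qed (use prime k f E in auto)
  then show False
    using E(5) is_idealD(1)[OF prime_idealD(1)[OF prime[of 0]]] by simp
qed

lemma prime_height_var_ideal_ge:
  "enat (card W) \<le> prime_height (var_ideal W :: ('n::finite, 'k::field) mpoly set)"
proof -
  have "finite W"
    by simp
  then obtain e where e: "bij_betw e {..<card W} W"
    using ex_bij_betw_nat_finite[of W] by (auto simp: atLeast0LessThan)
  define Q :: "nat \<Rightarrow> ('n, 'k) mpoly set" where "Q i = var_ideal (e ` {..<i})" for i
  have "Q i \<subset> Q (Suc i)" if "i < card W" for i
    unfolding Q_def
  proof (rule var_ideal_strict_mono)
    have "e i \<notin> e ` {..<i}"
      using e that inj_on_image_mem_iff[of e "{..<card W}" i "{..<i}"] by (auto simp: bij_betw_def)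
    then show "e ` {..<i} \<subset> e ` {..<Suc i}"
      by (auto simp: lessThan_Suc)
  qed
  moreover have "Q (card W) = var_ideal W"
    using e by (simp add: Q_def bij_betw_def)
  moreover have "prime_ideal (Q i)" for i
    by (simp add: Q_def prime_var_ideal)
  ultimately show ?thesis
    unfolding prime_height_def by (intro Sup_upper) blast
qed

text \<open>If \<open>W\<close> misses a variable, a chain ending in \<open>var_ideal W\<close> can
  be prolonged by \<open>var_ideal UNIV\<close>, which improves the general bound by one.\<close>

lemma prime_height_var_ideal_le:
  assumes "W \<noteq> UNIV"
  shows "prime_height (var_ideal W :: ('n::finite, 'k::field) mpoly set) \<le> enat (CARD('n) - 1)"
  unfolding prime_height_def
proof (rule Sup_least)
  fix x
  assume "x \<in> {enat k |k. \<exists>Q. (\<forall>i\<le>k. prime_ideal (Q i)) \<and> (\<forall>i<k. Q i \<subset> Q (Suc i)) \<and>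
      Q k = (var_ideal W :: ('n, 'k) mpoly set)}"
  then obtain k and Q :: "nat \<Rightarrow> ('n, 'k) mpoly set" where x: "x = enat k"
    and Q: "\<And>i. i \<le> k \<Longrightarrow> prime_ideal (Q i)" "\<And>i. i < k \<Longrightarrow> Q i \<subset> Q (Suc i)" "Q k = var_ideal W"
    by blast
  define Q' where "Q' i = (if i \<le> k then Q i else var_ideal UNIV)" for i
  have "Suc k \<le> CARD('n)"
  proof (rule prime_chain_length_le[of _ Q'])
    show "prime_ideal (Q' i)" if "i \<le> Suc k" for i
      using Q prime_var_ideal by (auto simp: Q'_def)
    show "Q' i \<subset> Q' (Suc i)" if "i < Suc k" for i
    proof (cases "i = k")
      case True
      then show ?thesis
        using Q(3) var_ideal_strict_mono[of W UNIV] assms by (auto simp: Q'_def)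
    next
      case False
      then show ?thesis
        using Q(2) that by (auto simp: Q'_def)
    qed
  qed
  then show "x \<le> enat (CARD('n) - 1)"
    by (simp add: x)
qed

lemma prime_height_mono:
  assumes "prime_ideal P'" "P \<subseteq> P'"
  shows "prime_height P \<le> prime_height P'"
proof (cases "P = P'")
  case False
  then have strict: "P \<subset> P'"
    using assms(2) by blast
  show ?thesis
    unfolding prime_height_def
  proof (rule Sup_mono, safe)
    fix k Q
    assume Q: "\<forall>i\<le>k. prime_ideal (Q i)" "\<forall>i<k. Q i \<subset> Q (Suc i)" "P = Q k"
    define Q' where "Q' i = (if i \<le> k then Q i else P')" for i
    have "(\<forall>i\<le>Suc k. prime_ideal (Q' i)) \<and> (\<forall>i<Suc k. Q' i \<subset> Q' (Suc i)) \<and> Q' (Suc k) = P'"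
      using Q strict assms(1) by (auto simp: Q'_def less_Suc_eq)
    then show "\<exists>b\<in>{enat k |k. \<exists>Q. (\<forall>i\<le>k. prime_ideal (Q i)) \<and> (\<forall>i<k. Q i \<subset> Q (Suc i)) \<and> Q k = P'}.
        enat k \<le> b"
      by (intro bexI[of _ "enat (Suc k)"]) auto
  qed
qed simp

section \<open>The tangent cone of a numerical semigroup ring\<close>

lemma wdeg_in_submonoid:
  fixes \<alpha> :: "'n::finite \<Rightarrow>\<^sub>0 nat"
  assumes "0 \<in> M" "\<And>x y. x \<in> M \<Longrightarrow> y \<in> M \<Longrightarrow> x + y \<in> M"
    and "\<And>i. lookup \<alpha> i \<noteq> 0 \<Longrightarrow> a i \<in> M"
  shows "wdeg a \<alpha> \<in> M"
proof -
  have mult: "k * x \<in> M" if "x \<in> M" for k x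
    by (induction k) (use assms(1,2) that in auto)
  have "(\<Sum>i\<in>A. lookup \<alpha> i * a i) \<in> M" for A
  proof (induction A rule: infinite_finite_induct)
    case (insert i A)
    have "lookup \<alpha> i * a i \<in> M"
      using assms mult by (cases "lookup \<alpha> i = 0") auto
    then show ?case
      using insert assms(2) by simp
  qed (use assms(1) in auto)
  then show ?thesis
    by (simp add: wdeg_eq_sum)
qed

lemma monoid_gen_range: "monoid_gen (range a) = range (wdeg (a :: 'n::finite \<Rightarrow> nat))"
proof
  have "0 \<in> range (wdeg a)" "a i \<in> range (wdeg a)" for i
    using rangeI[of "wdeg a" 0] rangeI[of "wdeg a" "xvar i"] by simp_all
  moreover have "x + y \<in> range (wdeg a)" if "x \<in> range (wdeg a)" "y \<in> range (wdeg a)" for x y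
    using that by (auto simp: wdeg_add[symmetric] simp del: wdeg_zero)
  ultimately show "monoid_gen (range a) \<subseteq> range (wdeg a)"
    unfolding monoid_gen_def by (intro Inter_lower) blast
next
  show "range (wdeg a) \<subseteq> monoid_gen (range a)"
    unfolding monoid_gen_def by (auto intro!: wdeg_in_submonoid)
qed

lemma lookup_hcomp: "lookup (hcomp d f) \<alpha> = (if mdeg \<alpha> = d then lookup f \<alpha> else 0)"
proof -
  have "finite {\<alpha>. (if mdeg \<alpha> = d then lookup f \<alpha> else 0) \<noteq> 0}"
    by (rule finite_subset[OF _ finite_keys[of f]]) (auto simp: in_keys_iff)
  then show ?thesis
    by (simp add: hcomp_def)
qed

lemma coeff_semigroup_map: "coeff (semigroup_map a f) h = coeff_sum {\<alpha>. wdeg a \<alpha> = h} f"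
  by (subst coeff_sum_superset[OF finite_keys subset_refl])
    (auto simp: semigroup_map_def Polynomial.coeff_sum intro!: sum.cong)

lemma initial_form_homogeneous:
  assumes "homogeneous d f" "f \<noteq> 0"
  shows "initial_form f = f"
proof -
  have "mdeg ` keys f = {d}"
    using assms by (auto simp: homogeneous_def image_iff simp flip: keys_eq_empty)
  then show ?thesis
    by (intro poly_mapping_eqI)
      (use assms(1) in \<open>auto simp: initial_form_def lookup_hcomp homogeneous_def in_keys_iff\<close>)
qed

locale numerical_semigroup_gens =
  fixes a :: "'n::finite \<Rightarrow> nat" and H :: "nat set"
  assumes semigroup: "numerical_semigroup H"
    and inj_a: "inj a"
    and min_gens: "minimal_gen_set H (range a)"
begin

lemma H_eq: "H = range (wdeg a)"
  using min_gens by (simp add: minimal_gen_set_def monoid_gen_range)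

lemma wdeg_in_H: "wdeg a \<alpha> \<in> H"
  by (simp add: H_eq)

text \<open>A zero generator could be dropped, against minimality.\<close>

lemma gens_pos: "0 < a i"
proof (rule ccontr)
  assume "\<not> 0 < a i"
  then have "range a - {0} \<subset> range a"
    by force
  moreover have "monoid_gen (range a - {0}) = monoid_gen (range a)"
    unfolding monoid_gen_def by (intro arg_cong[where f = Inter] Collect_cong) auto
  ultimately show False
    using min_gens by (auto simp: minimal_gen_set_def)
qed

lemma mdeg_le_wdeg: "mdeg \<alpha> \<le> wdeg a \<alpha>"
  unfolding mdeg_eq_sum wdeg_eq_sum by (rule sum_mono) (use gens_pos in \<open>simp add: Suc_leI\<close>)

lemma finite_wdeg: "finite {\<alpha>. wdeg a \<alpha> = h}"
  by (rule finite_subset[OF _ finite_monoms_mdeg_le[of h]]) (use mdeg_le_wdeg in auto)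

text \<open>A factorization of \<open>a i\<close> that uses \<open>a i\<close> has nothing else in
  it, all generators being positive; one that avoids \<open>a i\<close> would make this generator
  redundant.\<close>

lemma wdeg_eq_gen:
  assumes "wdeg a \<alpha> = a i"
  shows "\<alpha> = xvar i"
proof (rule ccontr)
  assume neq: "\<alpha> \<noteq> xvar i"
  have zero: "lookup \<alpha> i = 0"
  proof (rule ccontr)
    assume "lookup \<alpha> i \<noteq> 0"
    then have "1 \<le> lookup \<alpha> i"
      by simp
    then obtain \<gamma> where \<gamma>: "\<alpha> = xvar i + \<gamma>"
      by (rule monom_split_var)
    then have "wdeg a \<gamma> = 0"
      using assms by (simp add: wdeg_add)
    then have "\<gamma> = 0"
      using mdeg_le_wdeg[of \<gamma>] by (simp add: mdeg_eq_0_iff)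
    then show False
      using \<gamma> neq by simp
  qed
  have "range a \<subseteq> M" if M: "0 \<in> M" "range a - {a i} \<subseteq> M" "\<forall>x\<in>M. \<forall>y\<in>M. x + y \<in> M" for M
  proof -
    have "wdeg a \<alpha> \<in> M"
    proof (rule wdeg_in_submonoid)
      fix j
      assume "lookup \<alpha> j \<noteq> 0"
      then have "j \<noteq> i"
        using zero by auto
      then show "a j \<in> M"
        using M(2) inj_a by (auto simp: inj_eq)
    qed (use M in auto)
    then show ?thesis
      using M(2) assms by auto
  qed
  then have "{M. 0 \<in> M \<and> range a - {a i} \<subseteq> M \<and> (\<forall>x\<in>M. \<forall>y\<in>M. x + y \<in> M)} =
      {M. 0 \<in> M \<and> range a \<subseteq> M \<and> (\<forall>x\<in>M. \<forall>y\<in>M. x + y \<in> M)}"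
    by blast
  then have "monoid_gen (range a - {a i}) = monoid_gen (range a)"
    by (simp add: monoid_gen_def)
  moreover have "range a - {a i} \<subset> range a"
    by blast
  ultimately show False
    using min_gens unfolding minimal_gen_set_def by metis
qed

section \<open>Factorizations of maximal length and the associated graded ring\<close>

definition max_len :: "nat \<Rightarrow> nat" where
  "max_len h = Max (mdeg ` {\<alpha>. wdeg a \<alpha> = h})"

text \<open>\<open>max_len h\<close> is the order of \<open>t^h\<close> with respect to the maximal
  ideal, and the fiber consists of the monomials whose image in the associated graded ring is the
  class of \<open>t^h\<close>. For \<open>h\<close> outside \<open>H\<close> the value of
  \<open>max_len h\<close> is arbitrary, but the fiber is empty.\<close>

definition fiber :: "nat \<Rightarrow> ('n \<Rightarrow>\<^sub>0 nat) set" where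
  "fiber h = {\<alpha>. wdeg a \<alpha> = h \<and> mdeg \<alpha> = max_len h}"

definition maximal :: "('n \<Rightarrow>\<^sub>0 nat) \<Rightarrow> bool" where
  "maximal \<alpha> \<longleftrightarrow> mdeg \<alpha> = max_len (wdeg a \<alpha>)"

lemma mdeg_le_max_len: "mdeg \<alpha> \<le> max_len (wdeg a \<alpha>)"
  unfolding max_len_def by (rule Max_ge) (use finite_wdeg in auto)

lemma fiber_wdeg_iff: "\<alpha> \<in> fiber h \<longleftrightarrow> maximal \<alpha> \<and> wdeg a \<alpha> = h"
  by (auto simp: fiber_def maximal_def)

lemma finite_fiber: "finite (fiber h)"
  by (rule finite_subset[OF _ finite_wdeg[of h]]) (auto simp: fiber_def)

lemma fiber_nonempty: "fiber (wdeg a \<alpha>) \<noteq> {}"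
proof -
  have "max_len (wdeg a \<alpha>) \<in> mdeg ` {\<beta>. wdeg a \<beta> = wdeg a \<alpha>}"
    unfolding max_len_def by (rule Max_in) (use finite_wdeg in auto)
  then show ?thesis
    by (force simp: fiber_def)
qed

text \<open>A longer factorization of a divisor would lengthen the whole product.\<close>

lemma maximal_add: "maximal (\<gamma> + \<alpha>) \<Longrightarrow> maximal \<alpha>"
proof -
  assume max: "maximal (\<gamma> + \<alpha>)"
  obtain \<beta> where \<beta>: "\<beta> \<in> fiber (wdeg a \<alpha>)"
    using fiber_nonempty by blast
  have "mdeg (\<gamma> + \<beta>) \<le> mdeg (\<gamma> + \<alpha>)"
    using mdeg_le_max_len[of "\<gamma> + \<beta>"] max \<beta> by (simp add: maximal_def wdeg_add fiber_def)
  then show ?thesis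
    using \<beta> mdeg_le_max_len[of \<alpha>] by (simp add: mdeg_add maximal_def fiber_def)
qed

text \<open>Pulling a fiber back along multiplication by a monomial gives a whole fiber or nothing.
  This is why the fiber sums have an ideal as common kernel.\<close>

lemma fiber_shift:
  assumes "\<gamma> + \<alpha> \<in> fiber h"
  shows "{\<beta>. \<gamma> + \<beta> \<in> fiber h} = fiber (wdeg a \<alpha>)"
proof -
  have "maximal \<alpha>"
    using assms maximal_add by (auto simp: fiber_wdeg_iff)
  then show ?thesis
    using assms by (auto simp: fiber_def mdeg_add wdeg_add maximal_def)
qed

text \<open>Neither 0 nor a minimal generator has a second factorization; consequently the tangent
  ideal starts in degree 2.\<close>

lemma mdeg_le_1_fiber:
  assumes "mdeg \<alpha> \<le> 1"
  shows "fiber (wdeg a \<alpha>) = {\<alpha>}"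
proof -
  have uniq: "\<beta> = \<alpha>" if "wdeg a \<beta> = wdeg a \<alpha>" for \<beta>
  proof (cases "mdeg \<alpha> = 0")
    case True
    then have "\<alpha> = 0"
      by (simp add: mdeg_eq_0_iff)
    then have "mdeg \<beta> = 0"
      using that mdeg_le_wdeg[of \<beta>] by simp
    then show ?thesis
      using \<open>\<alpha> = 0\<close> by (simp add: mdeg_eq_0_iff)
  next
    case False
    then have "mdeg \<alpha> = 1"
      using assms by simp
    then obtain i where "\<alpha> = xvar i"
      by (rule mdeg_1_cases)
    then show ?thesis
      using that wdeg_eq_gen[of \<beta> i] by simp
  qed
  moreover obtain \<beta> where "\<beta> \<in> fiber (wdeg a \<alpha>)"
    using fiber_nonempty by blast
  ultimately show ?thesis
    by (auto simp: fiber_def)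
qed

lemma maximal_if_mdeg_le_1: "mdeg \<alpha> \<le> 1 \<Longrightarrow> maximal \<alpha>"
  using mdeg_le_1_fiber fiber_wdeg_iff by blast

lemma is_ideal_fiber_sums:
  "is_ideal {f :: ('n, 'k::field) mpoly. \<forall>h. coeff_sum (fiber h) f = 0}"
proof (rule is_ideal_monomialI)
  fix \<gamma> c and f :: "('n, 'k) mpoly"
  assume f: "f \<in> {f. \<forall>h. coeff_sum (fiber h) f = 0}"
  have "coeff_sum (fiber h) (single \<gamma> c * f) = 0" for h
  proof (cases "\<exists>\<alpha>. \<gamma> + \<alpha> \<in> fiber h")
    case True
    then obtain \<alpha> where "\<gamma> + \<alpha> \<in> fiber h" ..
    then show ?thesis
      using f by (simp add: coeff_sum_single_times fiber_shift)
  next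
    case False
    then have "{\<alpha>. \<gamma> + \<alpha> \<in> fiber h} = {}"
      by blast
    then show ?thesis
      by (simp add: coeff_sum_single_times)
  qed
  then show "single \<gamma> c * f \<in> {f. \<forall>h. coeff_sum (fiber h) f = 0}"
    by simp
qed (simp_all add: coeff_sum_add)

text \<open>If \<open>max_len h\<close> is the least degree of \<open>f\<close>, all terms of weight
  \<open>h\<close> in \<open>f\<close> are squeezed into that degree, so the sum is the coefficient
  of \<open>t^h\<close> in the image of \<open>f\<close>. Otherwise the fiber lies in a degree that
  the initial form does not have.\<close>

lemma fiber_sum_initial_form:
  fixes f :: "('n, 'k::field) mpoly"
  assumes "f \<in> toric_ideal a" "f \<noteq> 0"
  shows "coeff_sum (fiber h) (initial_form f) = 0"
proof -
  let ?d = "Min (mdeg ` keys f)"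
  have d: "?d \<le> mdeg \<alpha>" if "\<alpha> \<in> keys f" for \<alpha>
    using that by (intro Min_le) auto
  have keys: "keys (initial_form f) \<subseteq> keys f"
    by (auto simp: initial_form_def in_keys_iff lookup_hcomp split: if_splits)
  have "coeff_sum (fiber h) (initial_form f) =
      (\<Sum>\<alpha>\<in>keys f. if \<alpha> \<in> fiber h then lookup (initial_form f) \<alpha> else 0)"
    by (rule coeff_sum_superset) (use keys in auto)
  also have "\<dots> = 0"
  proof (cases "max_len h = ?d")
    case True
    have "(\<Sum>\<alpha>\<in>keys f. if \<alpha> \<in> fiber h then lookup (initial_form f) \<alpha> else 0) =
        (\<Sum>\<alpha>\<in>keys f. if \<alpha> \<in> {\<alpha>. wdeg a \<alpha> = h} then lookup f \<alpha> else 0)"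
    proof (rule sum.cong[OF refl])
      fix \<alpha>
      assume "\<alpha> \<in> keys f"
      then have "wdeg a \<alpha> = h \<Longrightarrow> mdeg \<alpha> = ?d"
        using d[of \<alpha>] mdeg_le_max_len[of \<alpha>] True by (metis le_antisym)
      then show "(if \<alpha> \<in> fiber h then lookup (initial_form f) \<alpha> else 0) =
          (if \<alpha> \<in> {\<alpha>. wdeg a \<alpha> = h} then lookup f \<alpha> else 0)"
        using True by (auto simp: fiber_def initial_form_def lookup_hcomp)
    qed
    also have "\<dots> = coeff (semigroup_map a f) h"
      by (simp only: coeff_semigroup_map coeff_sum_superset[OF finite_keys subset_refl])
    finally show ?thesis
      using assms(1) by (simp add: toric_ideal_def)
  next
    case False
    then show ?thesis
      by (intro sum.neutral) (auto simp: fiber_def initial_form_def lookup_hcomp)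
  qed
  finally show ?thesis .
qed

lemma binomial_in_toric_ideal:
  assumes "wdeg a \<alpha> = wdeg a \<beta>"
  shows "(single \<alpha> 1 - single \<beta> 1 :: ('n, 'k::field) mpoly) \<in> toric_ideal a"
  by (auto simp: toric_ideal_def poly_eq_iff coeff_semigroup_map coeff_sum_diff assms)

lemma initial_form_in_tangent_ideal:
  "f \<in> toric_ideal a \<Longrightarrow> f \<noteq> 0 \<Longrightarrow> initial_form f \<in> tangent_ideal a"
  unfolding tangent_ideal_def by (rule subsetD[OF ideal_gen_superset]) blast

lemma is_ideal_tangent_ideal: "is_ideal (tangent_ideal a :: ('n, 'k::field) mpoly set)"
  by (simp add: tangent_ideal_def is_ideal_ideal_gen)

text \<open>Subtracting a longer monomial of the same weight gives an element of the toric ideal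
  whose initial form is the shorter one.\<close>

lemma nonmaximal_in_tangent_ideal:
  assumes "\<not> maximal \<alpha>"
  shows "(single \<alpha> 1 :: ('n, 'k::field) mpoly) \<in> tangent_ideal a"
proof -
  obtain \<beta> where \<beta>: "\<beta> \<in> fiber (wdeg a \<alpha>)"
    using fiber_nonempty by blast
  then have less: "mdeg \<alpha> < mdeg \<beta>"
    using assms mdeg_le_max_len[of \<alpha>] by (auto simp: fiber_def maximal_def)
  then have "\<alpha> \<noteq> \<beta>"
    by auto
  let ?f = "single \<alpha> 1 - single \<beta> 1 :: ('n, 'k) mpoly"
  have keys: "keys ?f = {\<alpha>, \<beta>}"
    using \<open>\<alpha> \<noteq> \<beta>\<close> by (auto simp: in_keys_iff lookup_minus lookup_single when_def split: if_splits)
  then have "Min (mdeg ` keys ?f) = mdeg \<alpha>"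
    using less by simp
  then have "initial_form ?f = single \<alpha> 1"
    using less by (intro poly_mapping_eqI)
      (auto simp: initial_form_def lookup_hcomp lookup_minus lookup_single when_def)
  moreover have "?f \<noteq> 0"
    using keys by auto
  moreover have "?f \<in> toric_ideal a"
    using \<beta> by (intro binomial_in_toric_ideal) (simp add: fiber_def)
  ultimately show ?thesis
    using initial_form_in_tangent_ideal[of ?f] by simp
qed

lemma fiber_binomial_in_tangent_ideal:
  assumes "\<alpha> \<in> fiber h" "\<beta> \<in> fiber h"
  shows "(single \<alpha> 1 - single \<beta> 1 :: ('n, 'k::field) mpoly) \<in> tangent_ideal a"
proof (cases "\<alpha> = \<beta>")
  case True
  then show ?thesis
    using is_idealD(1)[OF is_ideal_tangent_ideal] by simp
next
  case False
  let ?f = "single \<alpha> 1 - single \<beta> 1 :: ('n, 'k) mpoly"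
  have keys: "keys ?f = {\<alpha>, \<beta>}"
    using False by (auto simp: in_keys_iff lookup_minus lookup_single when_def split: if_splits)
  have "homogeneous (max_len h) ?f"
    using assms by (auto simp: homogeneous_def keys fiber_def)
  moreover have "?f \<noteq> 0"
    using keys by auto
  moreover have "?f \<in> toric_ideal a"
    using assms by (intro binomial_in_toric_ideal) (simp add: fiber_def)
  ultimately show ?thesis
    using initial_form_in_tangent_ideal[of ?f] initial_form_homogeneous by metis
qed

section \<open>Standard monomials and reduction to normal form\<close>

definition normal_monom :: "nat \<Rightarrow> 'n \<Rightarrow>\<^sub>0 nat" where
  "normal_monom h = (SOME \<beta>. \<beta> \<in> fiber h \<and> (\<forall>\<beta>'\<in>fiber h. \<beta>' \<noteq> \<beta> \<longrightarrow> drl_less a \<beta> \<beta>'))"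

definition standard :: "('n \<Rightarrow>\<^sub>0 nat) \<Rightarrow> bool" where
  "standard \<alpha> \<longleftrightarrow> maximal \<alpha> \<and> normal_monom (wdeg a \<alpha>) = \<alpha>"

text \<open>A monomial minus its normal form, which is 0 for nonmaximal monomials. The result
  vanishes for standard \<open>\<alpha>\<close> and otherwise has leading monomial
  \<open>\<alpha>\<close>.\<close>

definition reducer :: "('n \<Rightarrow>\<^sub>0 nat) \<Rightarrow> ('n, 'k::field) mpoly" where
  "reducer \<alpha> = single \<alpha> 1 - (if maximal \<alpha> then single (normal_monom (wdeg a \<alpha>)) 1 else 0)"

lemma normal_monom_min:
  assumes "h \<in> H"
  shows "normal_monom h \<in> fiber h"
    and "\<beta>' \<in> fiber h \<Longrightarrow> \<beta>' \<noteq> normal_monom h \<Longrightarrow> drl_less a (normal_monom h) \<beta>'"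
proof -
  have "fiber h \<noteq> {}"
    using assms fiber_nonempty by (auto simp: H_eq)
  then have "\<exists>\<beta>. \<beta> \<in> fiber h \<and> (\<forall>\<beta>'\<in>fiber h. \<beta>' \<noteq> \<beta> \<longrightarrow> drl_less a \<beta> \<beta>')"
    using drl_min_exists[OF inj_a finite_fiber] by metis
  then have "normal_monom h \<in> fiber h \<and>
      (\<forall>\<beta>'\<in>fiber h. \<beta>' \<noteq> normal_monom h \<longrightarrow> drl_less a (normal_monom h) \<beta>')"
    unfolding normal_monom_def by (rule someI_ex)
  then show "normal_monom h \<in> fiber h"
    and "\<beta>' \<in> fiber h \<Longrightarrow> \<beta>' \<noteq> normal_monom h \<Longrightarrow> drl_less a (normal_monom h) \<beta>'"
    by auto
qed

lemma wdeg_normal_monom: "h \<in> H \<Longrightarrow> wdeg a (normal_monom h) = h"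
  using normal_monom_min(1) by (auto simp: fiber_def)

lemma standard_normal_monom: "h \<in> H \<Longrightarrow> standard (normal_monom h)"
  using normal_monom_min(1)[of h] by (auto simp: standard_def fiber_wdeg_iff)

lemma standard_inj: "standard \<alpha> \<Longrightarrow> standard \<beta> \<Longrightarrow> wdeg a \<alpha> = wdeg a \<beta> \<Longrightarrow> \<alpha> = \<beta>"
  by (metis standard_def)

lemma standardI:
  assumes "maximal \<alpha>" "\<And>\<beta>. \<beta> \<in> fiber (wdeg a \<alpha>) \<Longrightarrow> \<not> drl_less a \<beta> \<alpha>"
  shows "standard \<alpha>"
  using assms normal_monom_min[OF wdeg_in_H, of \<alpha>] by (metis fiber_wdeg_iff standard_def)

lemma nonstandardD:
  assumes "\<not> standard \<alpha>" "maximal \<alpha>"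
  shows "drl_less a (normal_monom (wdeg a \<alpha>)) \<alpha>" "mdeg (normal_monom (wdeg a \<alpha>)) = mdeg \<alpha>"
  using assms normal_monom_min[OF wdeg_in_H, of \<alpha>]
  by (auto simp: standard_def fiber_wdeg_iff) (simp add: maximal_def)

lemma standard_minimal: "standard \<alpha> \<Longrightarrow> \<beta> \<in> fiber (wdeg a \<alpha>) \<Longrightarrow> \<not> drl_less a \<beta> \<alpha>"
  using normal_monom_min(2)[OF wdeg_in_H, of \<beta> \<alpha>] drl_less_asym[OF inj_a] drl_less_irrefl
  by (metis standard_def)

text \<open>Translation by \<open>\<gamma>\<close> carries a smaller monomial in the fiber of
  \<open>\<alpha>\<close> to a smaller one in the fiber of the multiple, so standard monomials are
  closed under divisors.\<close>

lemma standard_add: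
  assumes "standard (\<gamma> + \<alpha>)"
  shows "standard \<alpha>"
proof (rule standardI)
  have max: "maximal (\<gamma> + \<alpha>)"
    using assms by (simp add: standard_def)
  then show "maximal \<alpha>"
    by (rule maximal_add)
  fix \<beta>
  assume "\<beta> \<in> fiber (wdeg a \<alpha>)"
  moreover have "\<gamma> + \<alpha> \<in> fiber (wdeg a (\<gamma> + \<alpha>))"
    using max by (simp add: fiber_wdeg_iff)
  ultimately have "\<gamma> + \<beta> \<in> fiber (wdeg a (\<gamma> + \<alpha>))"
    using fiber_shift by blast
  then show "\<not> drl_less a \<beta> \<alpha>"
    using standard_minimal[OF assms] drl_less_add_left_iff[OF inj_a] by blast
qed

lemma reducer_standard: "standard \<alpha> \<Longrightarrow> reducer \<alpha> = 0"
  by (simp add: standard_def reducer_def)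

lemma reducer_in_tangent_ideal: "(reducer \<alpha> :: ('n, 'k::field) mpoly) \<in> tangent_ideal a"
proof (cases "maximal \<alpha>")
  case True
  then have "\<alpha> \<in> fiber (wdeg a \<alpha>)"
    by (simp add: fiber_wdeg_iff)
  then show ?thesis
    using fiber_binomial_in_tangent_ideal[OF _ normal_monom_min(1)[OF wdeg_in_H]]
    by (simp add: reducer_def True)
qed (simp add: reducer_def nonmaximal_in_tangent_ideal)

lemma lookup_reducer_self: "\<not> standard \<alpha> \<Longrightarrow> lookup (reducer \<alpha>) \<alpha> = 1"
  by (auto simp: standard_def reducer_def lookup_minus lookup_single when_def)

lemma keys_reducer:
  "\<beta> \<in> keys (reducer \<alpha>) \<Longrightarrow> \<beta> = \<alpha> \<or> maximal \<alpha> \<and> \<beta> = normal_monom (wdeg a \<alpha>)"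
  by (auto simp: reducer_def in_keys_iff lookup_minus lookup_single when_def split: if_splits)

lemma lead_monom_reducer:
  assumes "\<not> standard \<alpha>"
  shows "lead_monom a (reducer \<alpha> :: ('n, 'k::field) mpoly) = \<alpha>"
proof (rule lead_monom_eqI[OF inj_a])
  show "\<alpha> \<in> keys (reducer \<alpha> :: ('n, 'k) mpoly)"
    using lookup_reducer_self[OF assms, where 'a = 'k] by (simp add: in_keys_iff)
  show "drl_less a \<beta> \<alpha>" if "\<beta> \<in> keys (reducer \<alpha> :: ('n, 'k) mpoly)" "\<beta> \<noteq> \<alpha>" for \<beta>
    using keys_reducer[OF that(1)] that(2) nonstandardD(1)[OF assms] by blast
qed

lemma homogeneous_reducer: "homogeneous (mdeg \<alpha>) (reducer \<alpha> :: ('n, 'k::field) mpoly)"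
  unfolding homogeneous_def
proof
  fix \<beta>
  assume "\<beta> \<in> keys (reducer \<alpha> :: ('n, 'k) mpoly)"
  then have "\<beta> = \<alpha> \<or> maximal \<alpha> \<and> \<beta> = normal_monom (wdeg a \<alpha>)"
    by (rule keys_reducer)
  then show "mdeg \<beta> = mdeg \<alpha>"
    using normal_monom_min(1)[OF wdeg_in_H, of \<alpha>]
    by (auto simp: fiber_def maximal_def)
qed

text \<open>What remains after subtracting the reducers is the sum of the normal forms of the terms;
  its coefficient at a standard monomial is a fiber sum, hence 0. The expansion involves reducers of
  terms of \<open>f\<close> alone, so a quadric becomes a combination of quadric reducers.\<close>

lemma fiber_sums_zero_reducer_expansion:
  fixes f :: "('n, 'k::field) mpoly"
  assumes "\<And>h. coeff_sum (fiber h) f = 0"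
  shows "f = (\<Sum>\<alpha>\<in>keys f. single 0 (lookup f \<alpha>) * reducer \<alpha>)"
proof -
  let ?n = "\<lambda>\<alpha>. normal_monom (wdeg a \<alpha>)"
  have "(\<Sum>\<alpha>\<in>keys f. if maximal \<alpha> then single (?n \<alpha>) (lookup f \<alpha>) else 0) = 0"
  proof (rule poly_mapping_eqI)
    fix \<beta>
    have "lookup (\<Sum>\<alpha>\<in>keys f. if maximal \<alpha> then single (?n \<alpha>) (lookup f \<alpha>) else 0) \<beta> =
        (\<Sum>\<alpha>\<in>keys f. if maximal \<alpha> \<and> ?n \<alpha> = \<beta> then lookup f \<alpha> else 0)"
      unfolding lookup_sum by (rule sum.cong) (auto simp: lookup_single when_def)
    also have "\<dots> = (\<Sum>\<alpha>\<in>keys f. if standard \<beta> \<and> \<alpha> \<in> fiber (wdeg a \<beta>) then lookup f \<alpha> else 0)"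
    proof (rule sum.cong[OF refl])
      fix \<alpha>
      have "maximal \<alpha> \<and> ?n \<alpha> = \<beta> \<longleftrightarrow> standard \<beta> \<and> \<alpha> \<in> fiber (wdeg a \<beta>)"
        using standard_normal_monom[OF wdeg_in_H, of \<alpha>] wdeg_normal_monom[OF wdeg_in_H, of \<alpha>]
        by (auto simp: fiber_wdeg_iff standard_def)
      then show "(if maximal \<alpha> \<and> ?n \<alpha> = \<beta> then lookup f \<alpha> else 0) =
          (if standard \<beta> \<and> \<alpha> \<in> fiber (wdeg a \<beta>) then lookup f \<alpha> else 0)"
        by simp
    qed
    also have "\<dots> = 0"
      using assms[of "wdeg a \<beta>"] unfolding coeff_sum_superset[OF finite_keys subset_refl]
      by (cases "standard \<beta>") simp_all
    finally show "lookup (\<Sum>\<alpha>\<in>keys f. if maximal \<alpha> then single (?n \<alpha>) (lookup f \<alpha>) else 0) \<beta> =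
        lookup 0 \<beta>"
      by simp
  qed
  moreover have "(\<Sum>\<alpha>\<in>keys f. single 0 (lookup f \<alpha>) * reducer \<alpha>) =
      (\<Sum>\<alpha>\<in>keys f. single \<alpha> (lookup f \<alpha>)) -
      (\<Sum>\<alpha>\<in>keys f. if maximal \<alpha> then single (?n \<alpha>) (lookup f \<alpha>) else 0)"
    unfolding sum_subtractf[symmetric]
    by (rule sum.cong) (auto simp: reducer_def right_diff_distrib mult_single)
  ultimately show ?thesis
    by (simp add: poly_mapping_sum_singles)
qed

text \<open>The right side is the kernel of the map from \<open>S\<close> onto the associated graded
  ring, read in the basis of classes of \<open>t^h\<close>. One inclusion is checked on initial
  forms, the other is the expansion into reducers.\<close>

lemma tangent_ideal_eq:
  "(tangent_ideal a :: ('n, 'k::field) mpoly set) = {f. \<forall>h. coeff_sum (fiber h) f = 0}"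
proof
  show "(tangent_ideal a :: ('n, 'k) mpoly set) \<subseteq> {f. \<forall>h. coeff_sum (fiber h) f = 0}"
    unfolding tangent_ideal_def
    by (rule ideal_gen_subset[OF is_ideal_fiber_sums]) (auto simp: fiber_sum_initial_form)
  show "{f. \<forall>h. coeff_sum (fiber h) f = 0} \<subseteq> (tangent_ideal a :: ('n, 'k) mpoly set)"
  proof
    fix f :: "('n, 'k) mpoly"
    assume "f \<in> {f. \<forall>h. coeff_sum (fiber h) f = 0}"
    then have "f = (\<Sum>\<alpha>\<in>keys f. single 0 (lookup f \<alpha>) * reducer \<alpha>)"
      by (intro fiber_sums_zero_reducer_expansion) auto
    moreover have "(\<Sum>\<alpha>\<in>keys f. single 0 (lookup f \<alpha>) * reducer \<alpha>) \<in> tangent_ideal a"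
      by (intro is_ideal_sum is_idealD(3) is_ideal_tangent_ideal reducer_in_tangent_ideal)
    ultimately show "f \<in> tangent_ideal a"
      by simp
  qed
qed

lemma tangent_ideal_reducer_expansion:
  "(f :: ('n, 'k::field) mpoly) \<in> tangent_ideal a \<Longrightarrow>
    f = (\<Sum>\<alpha>\<in>keys f. single 0 (lookup f \<alpha>) * reducer \<alpha>)"
  by (rule fiber_sums_zero_reducer_expansion) (simp add: tangent_ideal_eq)

lemma monomial_in_tangent_ideal_iff:
  "(single \<alpha> 1 :: ('n, 'k::field) mpoly) \<in> tangent_ideal a \<longleftrightarrow> \<not> maximal \<alpha>"
  by (auto simp: tangent_ideal_eq fiber_wdeg_iff)

text \<open>The remaining terms are smaller than the leading one, whereas a standard monomial is
  smallest in its fiber; so the leading coefficient alone would make up the sum over that fiber,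
  which is 0.\<close>

lemma lead_monom_nonstandard:
  fixes f :: "('n, 'k::field) mpoly"
  assumes "f \<in> tangent_ideal a" "f \<noteq> 0"
  shows "\<not> standard (lead_monom a f)"
proof
  let ?m = "lead_monom a f"
  assume std: "standard ?m"
  have "keys f \<inter> fiber (wdeg a ?m) = {?m}"
  proof
    show "keys f \<inter> fiber (wdeg a ?m) \<subseteq> {?m}"
      using lead_monom_max(2)[OF inj_a assms(2)] standard_minimal[OF std] by blast
    show "{?m} \<subseteq> keys f \<inter> fiber (wdeg a ?m)"
      using lead_monom_max(1)[OF inj_a assms(2)] std by (simp add: standard_def fiber_wdeg_iff)
  qed
  then have "coeff_sum (fiber (wdeg a ?m)) f = lookup f ?m"
    by (simp add: coeff_sum_def)
  moreover have "coeff_sum (fiber (wdeg a ?m)) f = 0"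
    using assms(1) by (simp add: tangent_ideal_eq)
  ultimately show False
    using lead_monom_max(1)[OF inj_a assms(2)] by (simp add: in_keys_iff)
qed

lemma standard_if_mdeg_le_1: "mdeg \<alpha> \<le> 1 \<Longrightarrow> standard \<alpha>"
  using mdeg_le_1_fiber[of \<alpha>] by (intro standardI) (auto simp: drl_less_irrefl maximal_if_mdeg_le_1)

lemma tangent_ideal_low_degree:
  fixes f :: "('n, 'k::field) mpoly"
  assumes "f \<in> tangent_ideal a" "mdeg \<alpha> < 2"
  shows "lookup f \<alpha> = 0"
proof -
  have "coeff_sum (fiber (wdeg a \<alpha>)) f = 0"
    using assms(1) by (simp add: tangent_ideal_eq)
  then show ?thesis
    using mdeg_le_1_fiber[of \<alpha>] assms(2) by (simp add: coeff_sum_singleton)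
qed

end

context numerical_semigroup_gens
begin

subsection \<open>The smallest generator\<close>

definition i0 :: 'n where
  "i0 = arg_min a (\<lambda>_. True)"

lemma i0_le: "a i0 \<le> a j"
  unfolding i0_def by (rule arg_min_nat_le) simp

lemma i0_less: "j \<noteq> i0 \<Longrightarrow> a i0 < a j"
  using i0_le[of j] inj_a by (metis inj_eq le_neq_implies_less)

lemma Min_gens: "Min (range a) = a i0"
  by (rule Min_eqI) (use i0_le in auto)

lemma wdeg_excess: "wdeg a \<alpha> = mdeg \<alpha> * a i0 + (\<Sum>j\<in>UNIV. lookup \<alpha> j * (a j - a i0))"
proof -
  have "lookup \<alpha> j * a j = lookup \<alpha> j * a i0 + lookup \<alpha> j * (a j - a i0)" for j
    using i0_le[of j] by (metis add_mult_distrib2 le_add_diff_inverse)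
  then show ?thesis
    by (simp add: wdeg_eq_sum mdeg_eq_sum sum_distrib_right sum.distrib)
qed

text \<open>Each factor weighs at least \<open>a i0\<close>, so \<open>k * a i0\<close> has at most
  \<open>k\<close> factors, and exactly \<open>k\<close> only if all of them are the smallest
  generator.\<close>

lemma fiber_power_i0: "fiber (k * a i0) = {single i0 k}"
proof -
  have le: "mdeg \<beta> \<le> k" if "wdeg a \<beta> = k * a i0" for \<beta>
  proof -
    have "mdeg \<beta> * a i0 \<le> k * a i0"
      using wdeg_excess[of \<beta>] that by simp
    then show ?thesis
      using gens_pos[of i0] by simp
  qed
  have len: "max_len (k * a i0) = k"
    unfolding max_len_def
  proof (rule Max_eqI)
    show "k \<in> mdeg ` {\<alpha>. wdeg a \<alpha> = k * a i0}"
      by (rule image_eqI[of _ _ "single i0 k"]) auto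
  qed (use le finite_wdeg in auto)
  have "\<beta> = single i0 k" if "wdeg a \<beta> = k * a i0" "mdeg \<beta> = k" for \<beta>
  proof -
    have "(\<Sum>j\<in>UNIV. lookup \<beta> j * (a j - a i0)) = 0"
      using wdeg_excess[of \<beta>] that by simp
    then have zero: "lookup \<beta> j = 0" if "j \<noteq> i0" for j
      using i0_less[OF that] by (auto simp: not_le[symmetric])
    then have "mdeg \<beta> = lookup \<beta> i0"
      unfolding mdeg_eq_sum by (subst sum.remove[of _ i0]) auto
    then show ?thesis
      using zero \<open>mdeg \<beta> = k\<close>
      by (intro poly_mapping_eqI) (auto simp: lookup_single when_def)
  qed
  then show ?thesis
    by (auto simp: fiber_def len)
qed

text \<open>\<open>x_j^(a i0)\<close> has the weight of \<open>x_1^(a j)\<close>, which is longer.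
  Every variable other than \<open>x_1\<close> is thus nilpotent modulo the tangent ideal.\<close>

lemma power_nonmaximal:
  assumes "j \<noteq> i0"
  shows "\<not> maximal (single j (a i0))"
proof
  assume "maximal (single j (a i0))"
  then have "max_len (a j * a i0) = a i0"
    by (simp add: maximal_def mult.commute)
  moreover have "max_len (a j * a i0) = a j"
    using singletonI[of "single i0 (a j)"] unfolding fiber_power_i0[symmetric]
    by (simp add: fiber_def)
  ultimately show False
    using i0_less[OF assms] by simp
qed

section \<open>The minimal prime and the height of the tangent ideal\<close>

lemma tangent_ideal_subset_var_ideal: "tangent_ideal a \<subseteq> var_ideal (- {i0})"
proof
  fix f :: "('n, 'b::field) mpoly"
  assume f: "f \<in> tangent_ideal a"
  have "lookup f \<alpha> = 0" if "\<forall>w\<in>- {i0}. lookup \<alpha> w = 0" for \<alpha>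
  proof -
    have "\<alpha> = single i0 (lookup \<alpha> i0)"
      using that by (intro poly_mapping_eqI) (auto simp: lookup_single when_def)
    moreover have "lookup f (single i0 k) = 0" for k
      using f fiber_power_i0[of k] coeff_sum_singleton[of "single i0 k" f]
      by (auto simp: tangent_ideal_eq dest: spec[of _ "k * a i0"])
    ultimately show ?thesis
      by metis
  qed
  then show "f \<in> var_ideal (- {i0})"
    by (simp add: var_ideal_def)
qed

text \<open>A prime over the tangent ideal contains a power of each variable other than
  \<open>x_1\<close>. The ideal of these variables is therefore the unique minimal prime, and the
  height is computed there.\<close>

lemma var_ideal_subset_prime:
  fixes P :: "('n, 'k::field) mpoly set"
  assumes "prime_ideal P" "tangent_ideal a \<subseteq> P"
  shows "var_ideal (- {i0}) \<subseteq> P"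
proof
  fix f :: "('n, 'k) mpoly"
  assume f: "f \<in> var_ideal (- {i0})"
  show "f \<in> P"
  proof (rule in_ideal_monomialsI)
    show "is_ideal P"
      using assms(1) by (simp add: prime_ideal_def)
    fix \<alpha>
    assume "\<alpha> \<in> keys f"
    then obtain w where w: "w \<noteq> i0" "lookup \<alpha> w \<noteq> 0"
      using f by (auto simp: var_ideal_def in_keys_iff)
    have "(single (single w (a i0)) 1 :: ('n, 'k) mpoly) \<in> P"
      using nonmaximal_in_tangent_ideal[OF power_nonmaximal[OF w(1)]] assms(2) by blast
    moreover have "single (single w k) (1 :: 'k) = single (xvar w) 1 ^ k" for k
    proof (induction k)
      case (Suc k)
      have "single w (Suc k) = xvar w + single w k"
        by (simp flip: single_add)
      then show ?case
        by (simp only: power_Suc Suc[symmetric] mult_single mult_1_left)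
    qed simp
    ultimately have xw: "(single (xvar w) 1 :: ('n, 'k) mpoly) \<in> P"
      using prime_ideal_power[OF assms(1)] by metis
    obtain \<gamma> where "\<alpha> = xvar w + \<gamma>"
      using w(2) by (metis monom_split_var One_nat_def Suc_leI neq0_conv)
    then have "single \<alpha> (1 :: 'k) = single (xvar w) 1 * single \<gamma> 1"
      by (simp add: mult_single)
    then show "single \<alpha> 1 \<in> P"
      using is_ideal_mult_right[OF \<open>is_ideal P\<close> xw] by simp
  qed
qed

lemma ideal_height_tangent_ideal:
  "ideal_height (tangent_ideal a :: ('n, 'k::field) mpoly set) = enat (CARD('n) - 1)"
proof -
  let ?P = "var_ideal (- {i0}) :: ('n, 'k) mpoly set"
  have ne: "- {i0} \<noteq> UNIV"
    by blast
  have "card (- {i0}) = CARD('n) - 1"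
    by (simp add: Compl_eq_Diff_UNIV)
  then have height: "prime_height ?P = enat (CARD('n) - 1)"
    using prime_height_var_ideal_ge[of "- {i0}", where 'k = 'k]
      prime_height_var_ideal_le[OF ne, where 'k = 'k] by simp
  show ?thesis
    unfolding ideal_height_def
  proof (rule Inf_eqI)
    fix y
    assume "\<And>x. x \<in> {prime_height P |P. prime_ideal P \<and> tangent_ideal a \<subseteq> (P :: ('n, 'k) mpoly set)} \<Longrightarrow>
        y \<le> x"
    then have "y \<le> prime_height ?P"
      using prime_var_ideal tangent_ideal_subset_var_ideal by blast
    then show "y \<le> enat (CARD('n) - 1)"
      by (simp add: height)
  next
    fix x
    assume "x \<in> {prime_height P |P. prime_ideal P \<and> tangent_ideal a \<subseteq> (P :: ('n, 'k) mpoly set)}"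
    then obtain P :: "('n, 'k) mpoly set"
      where "x = prime_height P" "prime_ideal P" "tangent_ideal a \<subseteq> P"
      by blast
    then show "enat (CARD('n) - 1) \<le> x"
      using prime_height_mono[of P ?P] var_ideal_subset_prime[of P] height by simp
  qed
qed

text \<open>The ideal of the variables other than \<open>x_1\<close> and the ideal of all variables
  form a chain over the tangent ideal, so dimension and depth are at least 1; the first entry of a
  nonempty regular sequence is \<open>y\<close>.\<close>

lemma cohen_macaulay_regular_element:
  assumes "cohen_macaulay_quot (tangent_ideal a :: ('n, 'k::field) mpoly set)"
  obtains y :: "('n, 'k::field) mpoly"
  where "lookup y 0 = 0" "\<And>g. y * g \<in> tangent_ideal a \<Longrightarrow> g \<in> tangent_ideal a"
proof -
  let ?I = "tangent_ideal a :: ('n, 'k) mpoly set"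
  define P :: "nat \<Rightarrow> ('n, 'k) mpoly set"
    where "P i = (if i = 0 then var_ideal (- {i0}) else var_ideal UNIV)" for i
  have "\<forall>i\<le>1. prime_ideal (P i) \<and> ?I \<subseteq> P i"
    using tangent_ideal_subset_var_ideal var_ideal_mono[of "- {i0}" UNIV]
    by (auto simp: P_def prime_var_ideal)
  moreover have "\<forall>i<1. P i \<subset> P (Suc i)"
    using var_ideal_strict_mono[of "- {i0}" UNIV] by (auto simp: P_def)
  ultimately have "enat 1 \<le> krull_dim_quot ?I"
    unfolding krull_dim_quot_def by (intro Sup_upper) blast
  then have depth: "enat 1 \<le> depth_quot ?I"
    using assms by (simp add: cohen_macaulay_quot_def)
  have "\<exists>fs. regular_seq_quot ?I fs \<and> fs \<noteq> []"
  proof (rule ccontr)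
    assume "\<not> ?thesis"
    then have "depth_quot ?I \<le> 0"
      unfolding depth_quot_def by (intro Sup_least) (auto simp: zero_enat_def)
    then show False
      using order_trans[OF depth] by (fastforce simp: zero_enat_def)
  qed
  then obtain y fs where "regular_seq_quot ?I (y # fs)"
    by (metis neq_Nil_conv)
  then have "y \<in> hom_max_ideal"
    and reg: "\<forall>i<length (y # fs). \<forall>g. (y # fs) ! i * g \<in> ideal_gen (?I \<union> set (take i (y # fs))) \<longrightarrow>
      g \<in> ideal_gen (?I \<union> set (take i (y # fs)))"
    by (auto simp: regular_seq_quot_def)
  then show thesis
    using that[of y] spec[OF reg, of 0] ideal_gen_ideal[OF is_ideal_tangent_ideal[where 'k = 'k]]
    by (simp add: hom_max_ideal_def)
qed

text \<open>All variables other than the smallest one are nilpotent modulo the tangent ideal, so a power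
  of any element of the maximal ideal lies in the ideal generated by the smallest variable.\<close>
lemma cohen_macaulay_maximal_shift:
  assumes "cohen_macaulay_quot (tangent_ideal a :: ('n, 'k::field) mpoly set)" "maximal \<alpha>"
  shows "maximal (xvar i0 + \<alpha>)"
proof (rule ccontr)
  assume "\<not> maximal (xvar i0 + \<alpha>)"
  then have x0: "(single (xvar i0 + \<alpha>) 1 :: ('n, 'k) mpoly) \<in> tangent_ideal a"
    by (rule nonmaximal_in_tangent_ideal)
  obtain y :: "('n, 'k) mpoly"
    where y: "lookup y 0 = 0" "\<And>g. y * g \<in> tangent_ideal a \<Longrightarrow> g \<in> tangent_ideal a"
    by (rule cohen_macaulay_regular_element[OF assms(1)]) blast
  \<comment> \<open>The colon ideal of \<open>x^\<alpha>\<close>. It is enough that it contains a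
    power of \<open>y\<close>: regularity then puts \<open>x^\<alpha>\<close> itself into the
    tangent ideal, against maximality.\<close>
  define U where "U = {r :: ('n, 'k) mpoly. r * single \<alpha> 1 \<in> tangent_ideal a}"
  note ideal_I = is_ideal_tangent_ideal[where 'k = 'k]
  have ideal_U: "is_ideal U"
    using is_idealD[OF ideal_I] by (simp add: U_def is_ideal_def distrib_right mult.assoc)
  have var_power: "(single (single j (a i0)) 1 :: ('n, 'k) mpoly) \<in> U" for j
  proof (cases "j = i0")
    case True
    have "single (single i0 (a i0 - 1)) (1 :: 'k) * single (xvar i0 + \<alpha>) 1 =
        single (single i0 (a i0)) 1 * single \<alpha> 1"
      using gens_pos[of i0] by (simp add: mult_single add.assoc[symmetric] single_add[symmetric])
    then show ?thesis
      using is_idealD(3)[OF ideal_I x0, of "single (single i0 (a i0 - 1)) 1"]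
      by (simp add: U_def True)
  next
    case False
    then show ?thesis
      using is_ideal_mult_right[OF ideal_I nonmaximal_in_tangent_ideal[OF power_nonmaximal]]
      by (simp add: U_def)
  qed
  \<comment> \<open>Pigeonhole: a monomial of degree at least \<open>CARD('n) * a i0\<close> has
    some exponent that reaches \<open>a i0\<close>.\<close>
  define N where "N = CARD('n) * a i0"
  have "y ^ N \<in> U"
  proof (rule in_ideal_monomialsI[OF ideal_U])
    fix \<beta>
    assume "\<beta> \<in> keys (y ^ N)"
    then have "N \<le> mdeg \<beta>"
      using low_degree_power[OF y(1), of \<beta> N] by (auto simp: in_keys_iff not_less[symmetric])
    have "\<exists>j. a i0 \<le> lookup \<beta> j"
    proof (rule ccontr)
      assume "\<not> ?thesis"
      then have "(\<Sum>j\<in>UNIV. lookup \<beta> j) < (\<Sum>j\<in>(UNIV :: 'n set). a i0)"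
        by (intro sum_strict_mono) (auto simp: not_le)
      then show False
        using \<open>N \<le> mdeg \<beta>\<close> by (simp add: mdeg_eq_sum N_def)
    qed
    then obtain j \<gamma> where "\<beta> = single j (a i0) + \<gamma>"
      by (metis monom_split_var)
    then have "single \<beta> (1 :: 'k) = single (single j (a i0)) 1 * single \<gamma> 1"
      by (simp add: mult_single)
    then show "single \<beta> 1 \<in> U"
      using is_ideal_mult_right[OF ideal_U var_power] by simp
  qed
  then have "y ^ N * single \<alpha> 1 \<in> tangent_ideal a"
    by (simp add: U_def)
  moreover have "y ^ k * g \<in> tangent_ideal a \<Longrightarrow> g \<in> tangent_ideal a" for k g
    by (induction k) (use y(2) in \<open>auto simp: mult.assoc\<close>)
  ultimately show False
    using assms(2) monomial_in_tangent_ideal_iff by blast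
qed

end

subsection \<open>Counting standard monomials\<close>

text \<open>The assumption says that \<open>x_1\<close> is a nonzerodivisor on the associated graded
  ring: it carries the class of \<open>t^h\<close> to that of \<open>t^(h + a i0)\<close> and never
  to 0.\<close>

locale regular_semigroup_gens = numerical_semigroup_gens a H
  for a :: "'n::finite \<Rightarrow> nat" and H +
  assumes maximal_shift: "maximal \<alpha> \<Longrightarrow> maximal (xvar i0 + \<alpha>)"
begin

text \<open>A smaller monomial of the same degree has at least as large an exponent at
  \<open>i0\<close>, so it is divisible by \<open>x_1\<close>; dividing both by \<open>x_1\<close>
  would contradict that \<open>\<alpha>\<close> is standard.\<close>

lemma standard_shift:
  assumes "standard \<alpha>"
  shows "standard (xvar i0 + \<alpha>)"
proof (rule standardI)
  show max: "maximal (xvar i0 + \<alpha>)"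
    using assms maximal_shift by (simp add: standard_def)
  then have mem: "xvar i0 + \<alpha> \<in> fiber (wdeg a (xvar i0 + \<alpha>))"
    by (simp add: fiber_wdeg_iff)
  fix \<beta>
  assume \<beta>: "\<beta> \<in> fiber (wdeg a (xvar i0 + \<alpha>))"
  show "\<not> drl_less a \<beta> (xvar i0 + \<alpha>)"
  proof
    assume less: "drl_less a \<beta> (xvar i0 + \<alpha>)"
    have "mdeg \<beta> = mdeg (xvar i0 + \<alpha>)"
      using \<beta> mem by (simp add: fiber_def)
    then obtain i where i: "lookup (xvar i0 + \<alpha>) i < lookup \<beta> i"
      "\<And>j. a j < a i \<Longrightarrow> lookup \<beta> j = lookup (xvar i0 + \<alpha>) j"
      using less drl_less_same_mdeg_iff[OF inj_a] by blast
    have "lookup (xvar i0 + \<alpha>) i0 \<le> lookup \<beta> i0"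
    proof (cases "i = i0")
      case False
      then show ?thesis
        using i(2)[OF i0_less] by simp
    qed (use i(1) in simp)
    then have "1 \<le> lookup \<beta> i0"
      by (simp add: lookup_add)
    then obtain \<beta>' where \<beta>': "\<beta> = xvar i0 + \<beta>'"
      by (rule monom_split_var)
    then have "\<beta>' \<in> fiber (wdeg a \<alpha>)"
      using \<beta> fiber_shift[OF mem] by blast
    moreover have "drl_less a \<beta>' \<alpha>"
      using less by (simp add: \<beta>' drl_less_add_left_iff[OF inj_a])
    ultimately show False
      using standard_minimal[OF assms] by blast
  qed
qed

lemma standard_shift_power: "standard \<alpha> \<Longrightarrow> standard (single i0 k + \<alpha>)"
proof (induction k)
  case (Suc k)
  have "single i0 (Suc k) + \<alpha> = xvar i0 + (single i0 k + \<alpha>)"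
    by (simp add: add.assoc[symmetric] single_add[symmetric])
  then show ?case
    using standard_shift Suc by simp
qed simp

section \<open>The Apery set\<close>

definition apery_monoms :: "('n \<Rightarrow>\<^sub>0 nat) set" where
  "apery_monoms = {\<alpha>. standard \<alpha> \<and> lookup \<alpha> i0 = 0}"

text \<open>Two such monomials in one residue class differ by a factor \<open>x_1^k\<close>, both
  being standard, and \<open>k = 0\<close> as neither involves \<open>x_1\<close>. Each class meets
  \<open>H\<close> because the complement is finite, and stripping \<open>x_1\<close> from a normal
  monomial of that class lands in the set.\<close>

lemma bij_apery_monoms: "bij_betw (\<lambda>\<alpha>. wdeg a \<alpha> mod a i0) apery_monoms {..<a i0}"
proof (rule bij_betw_imageI)
  have eq: "\<alpha> = \<beta>" if *: "\<alpha> \<in> apery_monoms" "\<beta> \<in> apery_monoms" "wdeg a \<alpha> \<le> wdeg a \<beta>"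
    "wdeg a \<alpha> mod a i0 = wdeg a \<beta> mod a i0" for \<alpha> \<beta>
  proof -
    obtain k where "wdeg a \<beta> = wdeg a \<alpha> + a i0 * k"
      using *(3,4) by (metis mod_eq_nat2E)
    then have "wdeg a (single i0 k + \<alpha>) = wdeg a \<beta>"
      by (simp add: wdeg_add)
    then have "single i0 k + \<alpha> = \<beta>"
      using *(1,2) standard_inj standard_shift_power by (simp add: apery_monoms_def)
    moreover from this have "k = 0"
      using *(1,2) by (auto simp: apery_monoms_def lookup_add)
    ultimately show ?thesis
      by simp
  qed
  show "inj_on (\<lambda>\<alpha>. wdeg a \<alpha> mod a i0) apery_monoms"
  proof (rule inj_onI)
    fix \<alpha> \<beta>
    assume "\<alpha> \<in> apery_monoms" "\<beta> \<in> apery_monoms" "wdeg a \<alpha> mod a i0 = wdeg a \<beta> mod a i0"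
    then show "\<alpha> = \<beta>"
      using eq[of \<alpha> \<beta>] eq[of \<beta> \<alpha>] by (cases "wdeg a \<alpha> \<le> wdeg a \<beta>") auto
  qed
  show "(\<lambda>\<alpha>. wdeg a \<alpha> mod a i0) ` apery_monoms = {..<a i0}"
  proof
    show "(\<lambda>\<alpha>. wdeg a \<alpha> mod a i0) ` apery_monoms \<subseteq> {..<a i0}"
      using gens_pos by auto
    show "{..<a i0} \<subseteq> (\<lambda>\<alpha>. wdeg a \<alpha> mod a i0) ` apery_monoms"
    proof
      fix r
      assume "r \<in> {..<a i0}"
      then have r: "r < a i0"
        by simp
      have "infinite (range (\<lambda>k. r + k * a i0))"
        using gens_pos[of i0] by (intro range_inj_infinite injI) simp
      then have "\<not> range (\<lambda>k. r + k * a i0) \<subseteq> UNIV - H"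
        using semigroup finite_subset by (auto simp: numerical_semigroup_def)
      then obtain k where h: "r + k * a i0 \<in> H"
        by blast
      let ?\<nu> = "normal_monom (r + k * a i0)"
      obtain \<gamma> where \<gamma>: "?\<nu> = single i0 (lookup ?\<nu> i0) + \<gamma>"
        by (rule monom_split_var[OF order_refl])
      have "lookup ?\<nu> i0 = lookup ?\<nu> i0 + lookup \<gamma> i0"
        by (subst (1) \<gamma>) (simp add: lookup_add)
      moreover have "standard \<gamma>"
        using standard_normal_monom[OF h] standard_add \<gamma> by metis
      ultimately have "\<gamma> \<in> apery_monoms"
        by (simp add: apery_monoms_def)
      moreover have "wdeg a \<gamma> mod a i0 = r"
      proof -
        have "r + k * a i0 = lookup ?\<nu> i0 * a i0 + wdeg a \<gamma>"
          using wdeg_normal_monom[OF h] by (subst (asm) \<gamma>) (simp add: wdeg_add)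
        then have "(r + k * a i0) mod a i0 = (lookup ?\<nu> i0 * a i0 + wdeg a \<gamma>) mod a i0"
          by simp
        then show ?thesis
          using r by simp
      qed
      ultimately show "r \<in> (\<lambda>\<alpha>. wdeg a \<alpha> mod a i0) ` apery_monoms"
        by force
    qed
  qed
qed

lemma finite_apery_monoms: "finite apery_monoms"
  using bij_betw_finite[OF bij_apery_monoms] by simp

lemma card_apery_monoms: "card apery_monoms = a i0"
  using bij_betw_same_card[OF bij_apery_monoms] by simp

text \<open>The monomial 1 and the \<open>n - 1\<close> variables other than \<open>x_1\<close> are
  Apery monomials.\<close>

lemma embdim_le_multiplicity: "CARD('n) \<le> a i0"
proof -
  have sub: "insert 0 (xvar ` (- {i0})) \<subseteq> apery_monoms"
    by (auto simp: apery_monoms_def standard_if_mdeg_le_1 lookup_single when_def)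
  have "inj (xvar :: 'n \<Rightarrow> _)"
    by (rule injI) (metis lookup_single_eq lookup_single_not_eq one_neq_zero)
  then have "card (xvar ` (- {i0})) = CARD('n) - 1"
    by (subst card_image) (auto intro: inj_on_subset simp: Compl_eq_Diff_UNIV)
  moreover have "(0 :: 'n \<Rightarrow>\<^sub>0 nat) \<notin> xvar ` (- {i0})"
    by (metis (no_types, lifting) imageE lookup_single_eq lookup_zero one_neq_zero)
  ultimately have "card (insert 0 (xvar ` (- {i0}))) = CARD('n)"
    by (subst card_insert_disjoint) auto
  then show ?thesis
    using card_mono[OF finite_apery_monoms sub] card_apery_monoms by simp
qed

section \<open>Counting squarefree monomials\<close>

definition squarefree_monoms :: "('n \<Rightarrow>\<^sub>0 nat) set" where
  "squarefree_monoms = {\<alpha>. lookup \<alpha> i0 = 0 \<and> (\<forall>j. lookup \<alpha> j \<le> 1)}"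

lemma bij_squarefree_monoms: "bij_betw keys squarefree_monoms (Pow (- {i0}))"
proof (rule bij_betw_imageI)
  show "inj_on keys squarefree_monoms"
  proof (rule inj_onI)
    fix \<alpha> \<beta>
    assume *: "\<alpha> \<in> squarefree_monoms" "\<beta> \<in> squarefree_monoms" "keys \<alpha> = keys \<beta>"
    show "\<alpha> = \<beta>"
    proof (rule poly_mapping_eqI)
      fix j
      have "lookup \<alpha> j \<noteq> 0 \<longleftrightarrow> lookup \<beta> j \<noteq> 0"
        using *(3) by (metis in_keys_iff)
      moreover have "lookup \<alpha> j \<le> 1" "lookup \<beta> j \<le> 1"
        using * by (auto simp: squarefree_monoms_def)
      ultimately show "lookup \<alpha> j = lookup \<beta> j"
        by linarith
    qed
  qed
  show "keys ` squarefree_monoms = Pow (- {i0})"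
  proof
    show "keys ` squarefree_monoms \<subseteq> Pow (- {i0})"
      by (auto simp: squarefree_monoms_def in_keys_iff)
    show "Pow (- {i0}) \<subseteq> keys ` squarefree_monoms"
    proof
      fix A
      assume A: "A \<in> Pow (- {i0})"
      let ?\<alpha> = "Abs_poly_mapping (\<lambda>j. if j \<in> A then 1 else 0 :: nat)"
      have l: "lookup ?\<alpha> = (\<lambda>j. if j \<in> A then 1 else 0)"
        by simp
      have "?\<alpha> \<in> squarefree_monoms"
        using A by (auto simp: squarefree_monoms_def l)
      moreover have "keys ?\<alpha> = A"
        by (auto simp: in_keys_iff l split: if_splits)
      ultimately show "A \<in> keys ` squarefree_monoms"
        by blast
    qed
  qed
qed

lemma card_compl_i0: "card (- {i0} :: 'n set) = CARD('n) - 1"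
  by (simp add: Compl_eq_Diff_UNIV)

lemma finite_squarefree_monoms: "finite squarefree_monoms"
  using bij_betw_finite[OF bij_squarefree_monoms] by simp

lemma card_squarefree_monoms: "card squarefree_monoms = 2 ^ (CARD('n) - 1)"
  using bij_betw_same_card[OF bij_squarefree_monoms] card_compl_i0 by (simp add: card_Pow)

text \<open>The excluded monomials contain both \<open>p\<close> and \<open>q\<close> and are free
  in the remaining \<open>n - 3\<close> variables. As \<open>i0\<close>, \<open>p\<close>,
  \<open>q\<close> are distinct, \<open>n\<close> is at least 3 and the subtraction in the exponent
  is exact.\<close>

lemma card_squarefree_monoms_avoiding:
  assumes "p \<noteq> q" "p \<noteq> i0" "q \<noteq> i0"
  shows "card {\<alpha>\<in>squarefree_monoms. lookup \<alpha> p = 0 \<or> lookup \<alpha> q = 0} =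
    2 ^ (CARD('n) - 1) - 2 ^ (CARD('n) - 3)"
proof -
  let ?D = "{\<alpha>\<in>squarefree_monoms. lookup \<alpha> p \<noteq> 0 \<and> lookup \<alpha> q \<noteq> 0}"
  have "card ?D = card (keys ` ?D)"
    using bij_squarefree_monoms
    by (intro card_image[symmetric]) (auto simp: bij_betw_def intro: inj_on_subset)
  also have "keys ` ?D = {A\<in>keys ` squarefree_monoms. p \<in> A \<and> q \<in> A}"
    by (auto simp: in_keys_iff)
  also have "\<dots> = {A\<in>Pow (- {i0}). p \<in> A \<and> q \<in> A}"
    using bij_squarefree_monoms by (simp add: bij_betw_def)
  also have "\<dots> = (\<lambda>B. {p, q} \<union> B) ` Pow (- {i0, p, q})"
  proof
    show "{A \<in> Pow (- {i0}). p \<in> A \<and> q \<in> A} \<subseteq> (\<lambda>B. {p, q} \<union> B) ` Pow (- {i0, p, q})"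
      by (auto intro!: image_eqI[of _ _ "_ - {p, q}"])
  qed (use assms in auto)
  also have "card \<dots> = card (Pow (- {i0, p, q}))"
    by (rule card_image) (auto simp: inj_on_def)
  also have "\<dots> = 2 ^ (CARD('n) - 3)"
    using assms by (simp add: card_Pow Compl_eq_Diff_UNIV card_Diff_subset)
  finally have cardD: "card ?D = 2 ^ (CARD('n) - 3)" .
  have "{\<alpha>\<in>squarefree_monoms. lookup \<alpha> p = 0 \<or> lookup \<alpha> q = 0} = squarefree_monoms - ?D"
    by auto
  then show ?thesis
    using cardD card_squarefree_monoms finite_squarefree_monoms by (simp add: card_Diff_subset)
qed

end

section \<open>Quadratic tangent cones\<close>

context numerical_semigroup_gens
begin

text \<open>A quadric in the tangent ideal expands into the reducers of its own terms, which all
  have degree 2; those of standard terms vanish.\<close>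

lemma tangent_ideal_subset_if_quadratic:
  fixes Q :: "('n, 'k::field) mpoly set"
  assumes "quadratic_ideal (tangent_ideal a :: ('n, 'k) mpoly set)" "is_ideal Q"
    and "\<And>\<mu>. \<not> standard \<mu> \<Longrightarrow> mdeg \<mu> = 2 \<Longrightarrow> reducer \<mu> \<in> Q"
  shows "tangent_ideal a \<subseteq> Q"
proof -
  obtain G where G: "\<forall>g\<in>G. homogeneous 2 g" "ideal_gen G = (tangent_ideal a :: ('n, 'k) mpoly set)"
    using assms(1) by (auto simp: quadratic_ideal_def)
  have "g \<in> Q" if "g \<in> G" for g
  proof -
    have "g \<in> tangent_ideal a"
      using that G(2) ideal_gen_superset by blast
    then have "g = (\<Sum>\<alpha>\<in>keys g. single 0 (lookup g \<alpha>) * reducer \<alpha>)"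
      by (rule tangent_ideal_reducer_expansion)
    also have "\<dots> \<in> Q"
    proof (intro is_ideal_sum is_idealD(3) assms(2))
      fix \<alpha>
      assume "\<alpha> \<in> keys g"
      then have "mdeg \<alpha> = 2"
        using G(1) that by (simp add: homogeneous_def)
      then show "reducer \<alpha> \<in> Q"
        using assms(3)[of \<alpha>] is_idealD(1)[OF assms(2)]
        by (cases "standard \<alpha>") (simp_all add: reducer_standard)
    qed
    finally show ?thesis .
  qed
  then show ?thesis
    using ideal_gen_subset[OF assms(2)] G(2) by blast
qed

text \<open>If \<open>a p + a q = 2 * a j\<close> with distinct summands, one of them is below
  \<open>a j\<close>, and a factor with small generator makes a monomial small. So
  \<open>x_j^2\<close> is the largest quadric of its weight.\<close>

lemma drl_less_square:
  assumes "mdeg \<mu> = 2" "wdeg a \<mu> = 2 * a j" "\<mu> \<noteq> single j 2"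
  shows "drl_less a \<mu> (single j 2)"
proof -
  obtain p q where \<mu>: "\<mu> = xvar p + xvar q" and le: "a p \<le> a q"
    using mdeg_2_cases[OF assms(1)] by (metis add.commute linorder_le_cases)
  have sum: "a p + a q = 2 * a j"
    using assms(2) by (simp add: \<mu> wdeg_add)
  have "a p \<noteq> a j"
  proof
    assume "a p = a j"
    then have "p = j" "q = j"
      using sum inj_a by (auto simp: inj_eq)
    then show False
      using assms(3) by (simp add: \<mu> single_add[symmetric] numeral_2_eq_2)
  qed
  then have "a p < a j"
    using sum le by linarith
  then have "lookup (single j 2) p < lookup \<mu> p"
    by (auto simp: \<mu> lookup_add lookup_single when_def)
  moreover have "lookup \<mu> i = lookup (single j 2) i" if "a i < a p" for i
    using that le \<open>a p < a j\<close> by (auto simp: \<mu> lookup_add lookup_single when_def)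
  ultimately show ?thesis
    using drl_less_same_mdeg_iff[OF inj_a, of \<mu> "single j 2"] assms(1) by auto
qed

text \<open>Otherwise no quadric of the tangent ideal would involve \<open>x\<^sub>j\<^sup>2\<close>, so the tangent ideal would lie
  in the ideal of the other variables, although it contains a power of \<open>x\<^sub>j\<close>.\<close>
lemma square_nonstandard:
  assumes quad: "quadratic_ideal (tangent_ideal a :: ('n, 'k::field) mpoly set)"
    and j: "j \<noteq> i0"
  shows "\<not> standard (single j 2)"
proof
  assume std: "standard (single j 2)"
  have "(tangent_ideal a :: ('n, 'k) mpoly set) \<subseteq> var_ideal (- {j})"
  proof (rule tangent_ideal_subset_if_quadratic[OF quad is_ideal_var_ideal])
    fix \<mu>
    assume \<mu>: "\<not> standard \<mu>" "mdeg \<mu> = 2"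
    have "\<alpha> \<notin> keys (reducer \<mu> :: ('n, 'k) mpoly)" if \<alpha>: "\<forall>w\<in>- {j}. lookup \<alpha> w = 0" for \<alpha>
    proof
      assume key: "\<alpha> \<in> keys (reducer \<mu> :: ('n, 'k) mpoly)"
      have eq: "\<alpha> = single j (lookup \<alpha> j)"
        using \<alpha> by (intro poly_mapping_eqI) (auto simp: lookup_single when_def)
      have "mdeg \<alpha> = 2"
        using homogeneous_reducer[of \<mu>] key \<mu>(2) by (auto simp: homogeneous_def)
      then have "\<alpha> = single j 2"
        using eq by (metis mdeg_single)
      \<comment> \<open>\<open>x_j^2\<close> is standard, so it can enter the reducer only as the
        normal form, the smallest monomial of its fiber; but it is the largest quadric of its
        weight.\<close>
      then have "maximal \<mu>" "normal_monom (wdeg a \<mu>) = single j 2"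
        using keys_reducer[OF key] \<mu>(1) std by auto
      moreover from this have "wdeg a \<mu> = 2 * a j"
        using wdeg_normal_monom[OF wdeg_in_H, of \<mu>] by simp
      ultimately have "drl_less a (single j 2) \<mu>" "drl_less a \<mu> (single j 2)"
        using nonstandardD(1)[OF \<mu>(1)] drl_less_square[OF \<mu>(2)] \<mu>(1) std by auto
      then show False
        using drl_less_asym[OF inj_a] by blast
    qed
    then show "(reducer \<mu> :: ('n, 'k) mpoly) \<in> var_ideal (- {j})"
      by (auto simp: var_ideal_def in_keys_iff)
  qed
  then have "(single (single j (a i0)) 1 :: ('n, 'k) mpoly) \<in> var_ideal (- {j})"
    using nonmaximal_in_tangent_ideal[OF power_nonmaximal[OF j]] by blast
  then show False
    by (auto simp: monomial_in_var_ideal_iff lookup_single when_def split: if_splits)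
qed

section \<open>The minimal number of generators\<close>

definition nonstandard_quadrics :: "('n \<Rightarrow>\<^sub>0 nat) set" where
  "nonstandard_quadrics = {\<mu>. \<not> standard \<mu> \<and> mdeg \<mu> = 2}"

lemma finite_nonstandard_quadrics: "finite nonstandard_quadrics"
  by (rule finite_subset[OF _ finite_monoms_mdeg_le[of 2]]) (auto simp: nonstandard_quadrics_def)

lemma reducer_nonzero: "\<not> standard \<mu> \<Longrightarrow> reducer \<mu> \<noteq> 0"
  by (metis lookup_reducer_self lookup_zero zero_neq_one)

lemma lookup_reducer_nonstandard:
  assumes "\<not> standard \<mu>" "\<not> standard \<nu>"
  shows "lookup (reducer \<mu> :: ('n, 'k::field) mpoly) \<nu> = (if \<nu> = \<mu> then 1 else 0)"
proof (cases "\<nu> = \<mu>")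
  case False
  then have "\<nu> \<notin> keys (reducer \<mu> :: ('n, 'k) mpoly)"
    using keys_reducer[of \<nu> \<mu>, where 'a = 'k] standard_normal_monom[OF wdeg_in_H, of \<mu>] assms(2)
    by blast
  then show ?thesis
    using False by (simp add: in_keys_iff)
qed (use assms in \<open>simp add: lookup_reducer_self\<close>)

lemma ideal_gen_quadric_reducers:
  assumes "quadratic_ideal (tangent_ideal a :: ('n, 'k::field) mpoly set)"
  shows "ideal_gen (reducer ` nonstandard_quadrics) = (tangent_ideal a :: ('n, 'k) mpoly set)"
proof
  show "ideal_gen (reducer ` nonstandard_quadrics) \<subseteq> (tangent_ideal a :: ('n, 'k) mpoly set)"
    by (rule ideal_gen_subset[OF is_ideal_tangent_ideal]) (auto simp: reducer_in_tangent_ideal)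
  show "(tangent_ideal a :: ('n, 'k) mpoly set) \<subseteq> ideal_gen (reducer ` nonstandard_quadrics)"
  proof (rule tangent_ideal_subset_if_quadratic[OF assms is_ideal_ideal_gen])
    fix \<mu>
    assume "\<not> standard \<mu>" "mdeg \<mu> = 2"
    then show "(reducer \<mu> :: ('n, 'k) mpoly) \<in> ideal_gen (reducer ` nonstandard_quadrics)"
      by (intro subsetD[OF ideal_gen_superset]) (simp add: nonstandard_quadrics_def)
  qed
qed

text \<open>Graded Nakayama by linear algebra, for possibly inhomogeneous generators. If there are
  fewer of them than nonstandard quadrics, some nonzero functional \<open>c\<close> on the
  coefficients of these quadrics kills them all. As the tangent ideal starts in degree 2,
  multiplication by nonconstant terms contributes nothing in degree 2, so \<open>c\<close> kills the
  whole ideal; but on the reducer of \<open>\<mu>\<close> it takes the value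
  \<open>c \<mu>\<close>.\<close>

lemma num_gens_tangent_ideal:
  assumes "quadratic_ideal (tangent_ideal a :: ('n, 'k::field) mpoly set)"
  shows "num_gens (tangent_ideal a :: ('n, 'k) mpoly set) = card nonstandard_quadrics"
  unfolding num_gens_def
proof (rule Least_equality)
  have "inj_on (reducer :: _ \<Rightarrow> ('n, 'k) mpoly) nonstandard_quadrics"
    by (rule inj_on_inverseI[of _ "lead_monom a"])
      (simp add: nonstandard_quadrics_def lead_monom_reducer)
  then show "\<exists>G. finite G \<and> card G = card nonstandard_quadrics \<and>
      ideal_gen G = (tangent_ideal a :: ('n, 'k) mpoly set)"
    using ideal_gen_quadric_reducers[OF assms] finite_nonstandard_quadrics
    by (intro exI[of _ "reducer ` nonstandard_quadrics"]) (simp add: card_image)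
next
  fix k
  assume "\<exists>G. finite G \<and> card G = k \<and> ideal_gen G = (tangent_ideal a :: ('n, 'k) mpoly set)"
  then obtain G :: "('n, 'k) mpoly set"
    where G: "finite G" "card G = k" "ideal_gen G = tangent_ideal a"
    by blast
  show "card nonstandard_quadrics \<le> k"
  proof (rule ccontr)
    assume "\<not> ?thesis"
    then have "card G < card nonstandard_quadrics"
      using G(2) by simp
    then obtain c where c: "\<exists>\<mu>\<in>nonstandard_quadrics. c \<mu> \<noteq> 0"
      "\<forall>g\<in>G. (\<Sum>\<mu>\<in>nonstandard_quadrics. c \<mu> * lookup g \<mu>) = 0"
      using homogeneous_system_nontrivial[OF G(1) finite_nonstandard_quadrics, of lookup] by blast
    define L where "L = {f :: ('n, 'k) mpoly. \<forall>\<alpha>. mdeg \<alpha> < 2 \<longrightarrow> lookup f \<alpha> = 0}"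
    \<comment> \<open>Membership in \<open>L\<close> makes this an ideal: a nonconstant term moves
      elements of \<open>L\<close> to degrees above 2, where \<open>c\<close> does not look.\<close>
    define Q where "Q = {f \<in> L. (\<Sum>\<mu>\<in>nonstandard_quadrics. c \<mu> * lookup f \<mu>) = 0}"
    have ideal_L: "is_ideal L"
      unfolding L_def by (rule low_degree_ideal)
    have "is_ideal Q"
    proof (rule is_ideal_monomialI)
      show "0 \<in> Q"
        using is_idealD(1)[OF ideal_L] by (simp add: Q_def)
      show "f + g \<in> Q" if "f \<in> Q" "g \<in> Q" for f g
        using that is_idealD(2)[OF ideal_L]
        by (simp add: Q_def lookup_add distrib_left sum.distrib)
    next
      fix \<gamma> d and f :: "('n, 'k) mpoly"
      assume f: "f \<in> Q"
      then have L: "single \<gamma> d * f \<in> L"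
        using is_idealD(3)[OF ideal_L] by (simp add: Q_def)
      have "(\<Sum>\<mu>\<in>nonstandard_quadrics. c \<mu> * lookup (single \<gamma> d * f) \<mu>) = 0"
      proof (cases "\<gamma> = 0")
        case True
        have "(\<Sum>\<mu>\<in>nonstandard_quadrics. c \<mu> * lookup (single \<gamma> d * f) \<mu>) =
            d * (\<Sum>\<mu>\<in>nonstandard_quadrics. c \<mu> * lookup f \<mu>)"
          unfolding sum_distrib_left
          by (rule sum.cong) (use lookup_single_times[of 0 d f] True in \<open>simp_all add: mult_ac\<close>)
        then show ?thesis
          using f by (simp add: Q_def)
      next
        case False
        have "lookup (single \<gamma> d * f) \<mu> = 0" if "\<mu> \<in> nonstandard_quadrics" for \<mu>
        proof (cases "\<exists>\<beta>. \<mu> = \<gamma> + \<beta>")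
          case True
          then obtain \<beta> where \<beta>: "\<mu> = \<gamma> + \<beta>" ..
          have "mdeg \<gamma> \<noteq> 0"
            using False by (simp add: mdeg_eq_0_iff)
          then have "mdeg \<beta> < 2"
            using that by (simp add: \<beta> nonstandard_quadrics_def mdeg_add)
          then have "lookup f \<beta> = 0"
            using f by (simp add: Q_def L_def)
          then show ?thesis
            by (simp add: \<beta> lookup_single_times)
        next
          case False
          then show ?thesis
            by (intro lookup_single_times_zero) blast
        qed
        then show ?thesis
          by simp
      qed
      then show "single \<gamma> d * f \<in> Q"
        using L by (simp add: Q_def)
    qed
    moreover have "G \<subseteq> Q"
    proof
      fix g
      assume "g \<in> G"
      then have "g \<in> tangent_ideal a"
        using G(3) ideal_gen_superset[of G] by blast
      then show "g \<in> Q"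
        using c(2) \<open>g \<in> G\<close> tangent_ideal_low_degree[of g] by (simp add: Q_def L_def)
    qed
    ultimately have sub: "tangent_ideal a \<subseteq> Q"
      using ideal_gen_subset G(3) by blast
    obtain \<mu> where \<mu>: "\<mu> \<in> nonstandard_quadrics" "c \<mu> \<noteq> 0"
      using c(1) by blast
    have "(\<Sum>\<nu>\<in>nonstandard_quadrics. c \<nu> * lookup (reducer \<mu> :: ('n, 'k) mpoly) \<nu>) =
        (\<Sum>\<nu>\<in>nonstandard_quadrics. if \<nu> = \<mu> then c \<mu> else 0)"
      using \<mu>(1)
      by (intro sum.cong) (auto simp: nonstandard_quadrics_def lookup_reducer_nonstandard)
    also have "\<dots> = c \<mu>"
      using \<mu>(1) finite_nonstandard_quadrics by simp
    finally show False
      using subsetD[OF sub reducer_in_tangent_ideal, of \<mu>] \<mu>(2) by (simp add: Q_def)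
  qed
qed

end

context regular_semigroup_gens
begin

section \<open>Squarefree standard monomials and the rewriting of squares\<close>

lemma apery_monoms_squarefree:
  assumes "quadratic_ideal (tangent_ideal a :: ('n, 'k::field) mpoly set)"
  shows "apery_monoms \<subseteq> squarefree_monoms"
proof
  fix \<alpha>
  assume \<alpha>: "\<alpha> \<in> apery_monoms"
  have "lookup \<alpha> j \<le> 1" for j
  proof (rule ccontr)
    assume gt: "\<not> lookup \<alpha> j \<le> 1"
    then have "j \<noteq> i0"
      using \<alpha> by (auto simp: apery_monoms_def)
    have "2 \<le> lookup \<alpha> j"
      using gt by simp
    then obtain \<gamma> where "\<alpha> = single j 2 + \<gamma>"
      by (rule monom_split_var)
    then have "standard (single j 2)"
      using \<alpha> standard_add[of \<gamma> "single j 2"] by (simp add: apery_monoms_def add.commute)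
    then show False
      using square_nonstandard[OF assms \<open>j \<noteq> i0\<close>] by blast
  qed
  then show "\<alpha> \<in> squarefree_monoms"
    using \<alpha> by (simp add: apery_monoms_def squarefree_monoms_def)
qed

lemma apery_monoms_avoiding:
  assumes "quadratic_ideal (tangent_ideal a :: ('n, 'k::field) mpoly set)"
    and "\<not> standard (xvar p + xvar q)" "p \<noteq> q"
  shows "apery_monoms \<subseteq> {\<alpha>\<in>squarefree_monoms. lookup \<alpha> p = 0 \<or> lookup \<alpha> q = 0}"
proof -
  have zero: "lookup \<alpha> p = 0 \<or> lookup \<alpha> q = 0" if \<alpha>: "standard \<alpha>" for \<alpha>
  proof (rule ccontr)
    assume nz: "\<not> ?thesis"
    have "lookup (xvar p + xvar q) i \<le> lookup \<alpha> i" for i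
      using nz assms(3) by (auto simp: lookup_add lookup_single when_def Suc_le_eq)
    then obtain \<gamma> where "\<alpha> = (xvar p + xvar q) + \<gamma>"
      by (rule monom_le_decomp)
    then show False
      using \<alpha> standard_add[of \<gamma> "xvar p + xvar q"] assms(2) by (simp add: add.commute)
  qed
  show ?thesis
  proof
    fix \<alpha>
    assume "\<alpha> \<in> apery_monoms"
    then show "\<alpha> \<in> {\<alpha>\<in>squarefree_monoms. lookup \<alpha> p = 0 \<or> lookup \<alpha> q = 0}"
      using apery_monoms_squarefree[OF assms(1)] zero[of \<alpha>] by (auto simp: apery_monoms_def)
  qed
qed

text \<open>Every rule sends a monomial to a monomial or to zero, so the rewriting runs on
  monomials; \<open>None\<close> is the zero polynomial, reached when \<open>x_j^2\<close> lies in
  the tangent ideal.\<close>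

definition square_step :: "('n \<Rightarrow>\<^sub>0 nat) option \<Rightarrow> ('n \<Rightarrow>\<^sub>0 nat) option \<Rightarrow> bool" where
  "square_step x y \<longleftrightarrow> (\<exists>j \<gamma>. j \<noteq> i0 \<and> x = Some (single j 2 + \<gamma>) \<and>
     y = (if maximal (single j 2) then Some (normal_monom (2 * a j) + \<gamma>) else None))"

lemma square_stepI1:
  "j \<noteq> i0 \<Longrightarrow> maximal (single j 2) \<Longrightarrow>
    square_step (Some (single j 2 + \<gamma>)) (Some (normal_monom (2 * a j) + \<gamma>))"
  by (auto simp: square_step_def)

lemma square_stepI2:
  "j \<noteq> i0 \<Longrightarrow> \<not> maximal (single j 2) \<Longrightarrow> square_step (Some (single j 2 + \<gamma>)) None"
  by (auto simp: square_step_def)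

text \<open>Two different squares in a monomial do not overlap; this replaces Buchberger's criterion for
  coprime leading monomials.\<close>
lemma square_step_confluent: "confluentp square_step"
proof (rule strong_confluentp_imp_confluentp, rule strong_confluentpI)
  fix x y z
  assume "square_step x y" "square_step x z"
  then obtain j \<gamma> k \<delta> where j: "j \<noteq> i0" "x = Some (single j 2 + \<gamma>)"
      "y = (if maximal (single j 2) then Some (normal_monom (2 * a j) + \<gamma>) else None)"
    and k: "k \<noteq> i0" "x = Some (single k 2 + \<delta>)"
      "z = (if maximal (single k 2) then Some (normal_monom (2 * a k) + \<delta>) else None)"
    unfolding square_step_def by blast
  have eq: "single j 2 + \<gamma> = single k 2 + \<delta>"
    using j k by simp
  show "\<exists>u. square_step\<^sup>*\<^sup>* y u \<and> square_step\<^sup>=\<^sup>= z u"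
  proof (cases "j = k")
    case True
    then have "y = z"
      using eq j k by simp
    then show ?thesis
      by blast
  next
    case False
    have "lookup (single j 2 + \<gamma>) k = lookup (single k 2 + \<delta>) k"
      by (simp add: eq)
    \<comment> \<open>Since \<open>k\<close> differs from \<open>j\<close>, the first step leaves
      the second square untouched, so both squares can be reduced in either order.\<close>
    then have "2 \<le> lookup \<gamma> k"
      using False by (simp add: lookup_add lookup_single when_def)
    then obtain \<epsilon> where \<gamma>: "\<gamma> = single k 2 + \<epsilon>"
      by (rule monom_split_var)
    then have \<delta>: "\<delta> = single j 2 + \<epsilon>"
      using eq by (metis add.left_commute add_left_cancel)
    let ?n = "\<lambda>j. normal_monom (2 * a j)"
    have y: "y = (if maximal (single j 2) then Some (single k 2 + (?n j + \<epsilon>)) else None)"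
      using j(3) by (simp add: \<gamma> add.left_commute)
    have z: "z = (if maximal (single k 2) then Some (single j 2 + (?n k + \<epsilon>)) else None)"
      using k(3) by (simp add: \<delta> add.left_commute)
    show ?thesis
    proof (cases "maximal (single j 2) \<and> maximal (single k 2)")
      case True
      have "square_step y (Some (?n k + (?n j + \<epsilon>)))"
        using True square_stepI1[OF k(1), of "?n j + \<epsilon>"] y by simp
      moreover have "square_step z (Some (?n j + (?n k + \<epsilon>)))"
        using True square_stepI1[OF j(1), of "?n k + \<epsilon>"] z by simp
      ultimately show ?thesis
        by (metis add.left_commute r_into_rtranclp sup2I1)
    next
      case False
      have "square_step\<^sup>*\<^sup>* y None"
        using False square_stepI2[OF k(1), of "?n j + \<epsilon>"] y by (auto intro: r_into_rtranclp)
      moreover have "square_step\<^sup>=\<^sup>= z None"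
        using False square_stepI2[OF j(1), of "?n k + \<epsilon>"] z by auto
      ultimately show ?thesis
        by blast
    qed
  qed
qed

lemma square_step_irreducible:
  assumes "\<And>j. j \<noteq> i0 \<Longrightarrow> lookup \<alpha> j \<le> 1" "square_step\<^sup>*\<^sup>* (Some \<alpha>) u"
  shows "u = Some \<alpha>"
proof -
  have "\<not> square_step (Some \<alpha>) y" for y
  proof
    assume "square_step (Some \<alpha>) y"
    then obtain j \<gamma> where "j \<noteq> i0" "\<alpha> = single j 2 + \<gamma>"
      by (auto simp: square_step_def)
    then show False
      using assms(1)[of j] by (simp add: lookup_add)
  qed
  then show ?thesis
    using assms(2) by (metis converse_rtranclpE)
qed

text \<open>By confluence a step cannot lose an irreducible target. The set of monomials that
  rewrite to \<open>\<alpha>\<close> is thus invariant under the rules in both directions.\<close>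

lemma square_step_reaches_iff:
  assumes irred: "\<And>j. j \<noteq> i0 \<Longrightarrow> lookup \<alpha> j \<le> 1" and step: "square_step x y"
  shows "square_step\<^sup>*\<^sup>* x (Some \<alpha>) \<longleftrightarrow> square_step\<^sup>*\<^sup>* y (Some \<alpha>)"
proof
  assume "square_step\<^sup>*\<^sup>* x (Some \<alpha>)"
  then obtain u where "square_step\<^sup>*\<^sup>* y u" "square_step\<^sup>*\<^sup>* (Some \<alpha>) u"
    using confluentpD[OF square_step_confluent r_into_rtranclp[of square_step, OF step]] by blast
  then show "square_step\<^sup>*\<^sup>* y (Some \<alpha>)"
    using square_step_irreducible[OF irred] by blast
qed (use step in \<open>rule converse_rtranclp_into_rtranclp\<close>)

lemma square_step_None: "square_step\<^sup>*\<^sup>* None u \<Longrightarrow> u = None"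
  by (induction rule: rtranclp_induct) (auto simp: square_step_def)

text \<open>Quadraticity makes each \<open>x_j^2\<close> nonstandard, so its normal monomial is
  smaller, and multiplication preserves the order.\<close>

lemma square_step_decreasing:
  assumes quad: "quadratic_ideal (tangent_ideal a :: ('n, 'k::field) mpoly set)"
    and "square_step\<^sup>*\<^sup>* (Some \<beta>) u"
  shows "u = Some \<alpha> \<Longrightarrow> \<alpha> = \<beta> \<or> drl_less a \<alpha> \<beta>"
  using assms(2)
proof (induction arbitrary: \<alpha> rule: rtranclp_induct)
  case (step y z)
  then obtain j \<gamma> where j: "j \<noteq> i0" "y = Some (single j 2 + \<gamma>)" "maximal (single j 2)"
    "\<alpha> = normal_monom (2 * a j) + \<gamma>"
    by (auto simp: square_step_def split: if_splits)
  have "drl_less a (normal_monom (2 * a j)) (single j 2)"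
    using nonstandardD(1)[OF square_nonstandard[OF quad j(1)] j(3)] by simp
  then have "drl_less a (\<gamma> + normal_monom (2 * a j)) (\<gamma> + single j 2)"
    by (simp only: drl_less_add_left_iff[OF inj_a])
  then have "drl_less a \<alpha> (single j 2 + \<gamma>)"
    by (simp only: j(4) add.commute)
  then show ?case
    using step.IH[OF j(2)] drl_less_trans[OF inj_a] by blast
qed auto

text \<open>The leading quadrics being squares, the quadric reducers are the rewriting rules.
  Summing coefficients over the monomials that rewrite to \<open>\<alpha>\<close> kills all
  multiples of the rules, hence the tangent ideal. This keeps \<open>x^\<alpha>\<close> out of that
  ideal, and puts every \<open>\<beta>\<close> in the fiber of \<open>\<alpha>\<close> among those
  monomials, none of which is smaller than \<open>\<alpha>\<close>.\<close>

lemma squarefree_standard: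
  assumes quad: "quadratic_ideal (tangent_ideal a :: ('n, 'k::field) mpoly set)"
    and pairs: "\<And>p q. p \<noteq> i0 \<Longrightarrow> q \<noteq> i0 \<Longrightarrow> p \<noteq> q \<Longrightarrow> standard (xvar p + xvar q)"
    and irred: "\<And>j. j \<noteq> i0 \<Longrightarrow> lookup \<alpha> j \<le> 1"
  shows "standard \<alpha>"
proof -
  define C where "C = {\<beta>. square_step\<^sup>*\<^sup>* (Some \<beta>) (Some \<alpha>)}"
  define Q where "Q = {f :: ('n, 'k) mpoly. \<forall>\<gamma>. coeff_sum {\<beta>. \<gamma> + \<beta> \<in> C} f = 0}"
  have sub: "tangent_ideal a \<subseteq> Q"
  proof (rule tangent_ideal_subset_if_quadratic[OF quad])
    show "is_ideal Q"
      unfolding Q_def by (rule coeff_sum_ideal)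
    fix \<mu>
    assume \<mu>: "\<not> standard \<mu>" "mdeg \<mu> = 2"
    obtain p q where pq: "\<mu> = xvar p + xvar q"
      by (rule mdeg_2_cases[OF \<mu>(2)])
    \<comment> \<open>A quadric divisible by \<open>x_1\<close> is standard, being the shift of a
      standard monomial of degree 1.\<close>
    have "p \<noteq> i0" "q \<noteq> i0"
      using \<mu>(1) standard_shift[OF standard_if_mdeg_le_1[of "xvar p"]]
        standard_shift[OF standard_if_mdeg_le_1[of "xvar q"]]
      by (auto simp: pq add.commute)
    then have "p = q"
      using pairs \<mu>(1) pq by blast
    then have \<mu>_eq: "\<mu> = single p 2"
      by (simp add: pq single_add[symmetric] numeral_2_eq_2)
    have "coeff_sum {\<beta>. \<gamma> + \<beta> \<in> C} (reducer \<mu> :: ('n, 'k) mpoly) = 0" for \<gamma>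
    proof (cases "maximal \<mu>")
      case True
      then have "square_step (Some (\<gamma> + single p 2)) (Some (\<gamma> + normal_monom (2 * a p)))"
        using square_stepI1[OF \<open>p \<noteq> i0\<close>, of \<gamma>] by (simp add: \<mu>_eq add.commute)
      then have "\<gamma> + single p 2 \<in> C \<longleftrightarrow> \<gamma> + normal_monom (2 * a p) \<in> C"
        unfolding C_def using square_step_reaches_iff[OF irred] by simp
      then show ?thesis
        using True by (simp add: reducer_def coeff_sum_diff \<mu>_eq)
    next
      case False
      then have "square_step (Some (\<gamma> + single p 2)) None"
        using square_stepI2[OF \<open>p \<noteq> i0\<close>, of \<gamma>] by (simp add: \<mu>_eq add.commute)
      then have "\<gamma> + single p 2 \<notin> C"
        unfolding C_def using square_step_reaches_iff[OF irred] square_step_None by blast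
      then show ?thesis
        using False by (simp add: reducer_def \<mu>_eq)
    qed
    then show "reducer \<mu> \<in> Q"
      by (simp add: Q_def)
  qed
  have zero: "coeff_sum C f = 0" if "f \<in> tangent_ideal a" for f :: "('n, 'k) mpoly"
  proof -
    have "coeff_sum {\<beta>. 0 + \<beta> \<in> C} f = 0"
      using sub that unfolding Q_def by blast
    then show ?thesis
      by simp
  qed
  have "\<alpha> \<in> C"
    by (simp add: C_def)
  show ?thesis
  proof (rule standardI)
    show max: "maximal \<alpha>"
      using zero[of "single \<alpha> 1"] \<open>\<alpha> \<in> C\<close> monomial_in_tangent_ideal_iff[of \<alpha>, where 'k = 'k]
      by auto
    fix \<beta>
    assume "\<beta> \<in> fiber (wdeg a \<alpha>)"
    then have "(single \<alpha> 1 - single \<beta> 1 :: ('n, 'k) mpoly) \<in> tangent_ideal a"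
      using max by (intro fiber_binomial_in_tangent_ideal) (auto simp: fiber_wdeg_iff)
    then have "\<beta> \<in> C"
      using zero[of "single \<alpha> 1 - single \<beta> 1"] \<open>\<alpha> \<in> C\<close> by (auto simp: coeff_sum_diff split: if_splits)
    then have "\<alpha> = \<beta> \<or> drl_less a \<alpha> \<beta>"
      using square_step_decreasing[OF quad] by (simp add: C_def)
    then show "\<not> drl_less a \<beta> \<alpha>"
      using drl_less_asym[OF inj_a] drl_less_irrefl by metis
  qed
qed

lemma multiplicity_cases:
  assumes quad: "quadratic_ideal (tangent_ideal a :: ('n, 'k::field) mpoly set)"
  obtains (full) "a i0 = 2 ^ (CARD('n) - 1)"
  | (pair) p q where "p \<noteq> i0" "q \<noteq> i0" "p \<noteq> q" "\<not> standard (xvar p + xvar q)"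
proof (cases "\<exists>p q. p \<noteq> i0 \<and> q \<noteq> i0 \<and> p \<noteq> q \<and> \<not> standard (xvar p + xvar q)")
  case True
  then show thesis
    using pair by blast
next
  case False
  have "squarefree_monoms \<subseteq> apery_monoms"
  proof
    fix \<alpha>
    assume \<alpha>: "\<alpha> \<in> squarefree_monoms"
    have "standard \<alpha>"
      by (rule squarefree_standard[OF quad]) (use False \<alpha> in \<open>auto simp: squarefree_monoms_def\<close>)
    then show "\<alpha> \<in> apery_monoms"
      using \<alpha> by (simp add: apery_monoms_def squarefree_monoms_def)
  qed
  then have "apery_monoms = squarefree_monoms"
    using apery_monoms_squarefree[OF quad] by blast
  then show thesis
    using full card_apery_monoms card_squarefree_monoms by simp
qed

lemma multiplicity_le_if_pair:
  assumes "quadratic_ideal (tangent_ideal a :: ('n, 'k::field) mpoly set)"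
    and "p \<noteq> i0" "q \<noteq> i0" "p \<noteq> q" "\<not> standard (xvar p + xvar q)"
  shows "a i0 \<le> 2 ^ (CARD('n) - 1) - 2 ^ (CARD('n) - 3)"
  using card_mono[OF _ apery_monoms_avoiding[OF assms(1,5,4)]] finite_squarefree_monoms
    card_squarefree_monoms_avoiding[OF assms(4,2,3)] card_apery_monoms
  by simp

section \<open>The extremal multiplicity\<close>

context
  fixes p q :: 'n
  assumes p: "p \<noteq> i0" and q: "q \<noteq> i0" and pq: "p \<noteq> q"
    and nonstd: "\<not> standard (xvar p + xvar q)"
    and extremal: "a i0 = 2 ^ (CARD('n) - 1) - 2 ^ (CARD('n) - 3)"
begin

lemma apery_monoms_extremal:
  assumes "quadratic_ideal (tangent_ideal a :: ('n, 'k::field) mpoly set)"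
  shows "apery_monoms = {\<alpha>\<in>squarefree_monoms. lookup \<alpha> p = 0 \<or> lookup \<alpha> q = 0}"
proof (rule card_subset_eq)
  show "apery_monoms \<subseteq> {\<alpha>\<in>squarefree_monoms. lookup \<alpha> p = 0 \<or> lookup \<alpha> q = 0}"
    by (rule apery_monoms_avoiding[OF assms nonstd pq])
qed (use finite_squarefree_monoms card_squarefree_monoms_avoiding[OF pq p q] card_apery_monoms
    extremal in auto)

lemma nonstandard_quadrics_supset:
  assumes "quadratic_ideal (tangent_ideal a :: ('n, 'k::field) mpoly set)"
  shows "insert (xvar p + xvar q) ((\<lambda>j. single j 2) ` (- {i0})) \<subseteq> nonstandard_quadrics"
  using square_nonstandard[OF assms] nonstd by (auto simp: nonstandard_quadrics_def mdeg_add)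

text \<open>Without a square factor in the variables other than \<open>x_1\<close>, removing the
  power of \<open>x_1\<close> leaves a squarefree monomial that is still nonstandard. By the
  equality of counts, the nonstandard ones among these are the multiples of
  \<open>x_p x_q\<close>.\<close>

lemma nonstandard_multiple:
  assumes quad: "quadratic_ideal (tangent_ideal a :: ('n, 'k::field) mpoly set)"
    and "\<not> standard \<alpha>"
  obtains \<mu> \<gamma> where "\<mu> \<in> insert (xvar p + xvar q) ((\<lambda>j. single j 2) ` (- {i0}))" "\<alpha> = \<mu> + \<gamma>"
proof (cases "\<exists>j. j \<noteq> i0 \<and> 2 \<le> lookup \<alpha> j")
  case True
  then obtain j where j: "j \<noteq> i0" "2 \<le> lookup \<alpha> j"
    by blast
  obtain \<gamma> where "\<alpha> = single j 2 + \<gamma>"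
    by (rule monom_split_var[OF j(2)])
  then show thesis
    using j(1) by (intro that[of "single j 2" \<gamma>]) auto
next
  case False
  define k where "k = lookup \<alpha> i0"
  then have "k \<le> lookup \<alpha> i0"
    by simp
  then obtain \<gamma> where \<gamma>: "\<alpha> = single i0 k + \<gamma>"
    by (rule monom_split_var)
  have l: "lookup \<alpha> i = (if i = i0 then k else 0) + lookup \<gamma> i" for i
    by (simp add: \<gamma> lookup_add lookup_single when_def)
  have "lookup \<gamma> i0 = 0"
    using l[of i0] by (simp add: k_def)
  moreover have "lookup \<gamma> j \<le> 1" for j
    using False l[of j] \<open>lookup \<gamma> i0 = 0\<close> by (cases "j = i0") auto
  ultimately have "\<gamma> \<in> squarefree_monoms"
    by (simp add: squarefree_monoms_def)
  have "\<not> standard \<gamma>"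
    using assms(2) standard_shift_power \<gamma> by metis
  then have "\<gamma> \<notin> apery_monoms"
    by (simp add: apery_monoms_def)
  then have "lookup \<gamma> p \<noteq> 0" "lookup \<gamma> q \<noteq> 0"
    unfolding apery_monoms_extremal[OF quad] using \<open>\<gamma> \<in> squarefree_monoms\<close> by simp_all
  then have "lookup (xvar p + xvar q) i \<le> lookup \<alpha> i" for i
    using l[of p] l[of q] pq p q by (auto simp: lookup_add lookup_single when_def Suc_le_eq)
  then obtain \<delta> where "\<alpha> = (xvar p + xvar q) + \<delta>"
    by (rule monom_le_decomp)
  then show thesis
    using that by blast
qed

lemma nonstandard_quadrics_extremal:
  assumes quad: "quadratic_ideal (tangent_ideal a :: ('n, 'k::field) mpoly set)"
  shows "nonstandard_quadrics = insert (xvar p + xvar q) ((\<lambda>j. single j 2) ` (- {i0}))"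
proof
  show "nonstandard_quadrics \<subseteq> insert (xvar p + xvar q) ((\<lambda>j. single j 2) ` (- {i0}))"
  proof
    fix \<alpha>
    assume \<alpha>: "\<alpha> \<in> nonstandard_quadrics"
    then obtain \<mu> \<gamma> where \<mu>: "\<mu> \<in> insert (xvar p + xvar q) ((\<lambda>j. single j 2) ` (- {i0}))" "\<alpha> = \<mu> + \<gamma>"
      using nonstandard_multiple[OF quad, of \<alpha>] by (auto simp: nonstandard_quadrics_def)
    then have "mdeg \<mu> = 2"
      using nonstandard_quadrics_supset[OF quad] by (auto simp: nonstandard_quadrics_def)
    then have "\<gamma> = 0"
      using \<alpha> \<mu>(2) by (simp add: nonstandard_quadrics_def mdeg_add mdeg_eq_0_iff)
    then show "\<alpha> \<in> insert (xvar p + xvar q) ((\<lambda>j. single j 2) ` (- {i0}))"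
      using \<mu> by simp
  qed
qed (rule nonstandard_quadrics_supset[OF quad])

lemma card_nonstandard_quadrics_extremal:
  assumes quad: "quadratic_ideal (tangent_ideal a :: ('n, 'k::field) mpoly set)"
  shows "card nonstandard_quadrics = CARD('n)"
proof -
  have "inj (\<lambda>j :: 'n. single j (2 :: nat))"
    by (rule injI) (metis lookup_single_eq lookup_single_not_eq zero_neq_numeral)
  then have "card ((\<lambda>j. single j (2 :: nat)) ` (- {i0})) = CARD('n) - 1"
    using card_compl_i0 by (simp add: card_image inj_on_subset)
  moreover have "xvar p + xvar q \<noteq> single j 2" for j
  proof
    assume "xvar p + xvar q = single j 2"
    then have "lookup (xvar p + xvar q) p = lookup (single j 2) p"
      by simp
    then show False
      using pq by (auto simp: lookup_add lookup_single when_def split: if_splits)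
  qed
  ultimately show ?thesis
    unfolding nonstandard_quadrics_extremal[OF quad] by (subst card_insert_disjoint) auto
qed

lemma almost_complete_intersection_extremal:
  assumes quad: "quadratic_ideal (tangent_ideal a :: ('n, 'k::field) mpoly set)"
  shows "almost_complete_intersection (tangent_ideal a :: ('n, 'k) mpoly set)"
  using num_gens_tangent_ideal[OF quad] card_nonstandard_quadrics_extremal[OF quad]
    ideal_height_tangent_ideal[where 'k = 'k]
  by (simp add: almost_complete_intersection_def one_enat_def)

text \<open>The leading monomial of an element of the ideal is nonstandard, hence a multiple of a
  nonstandard quadric, and that quadric is the leading monomial of its reducer.\<close>

lemma groebner_basis_extremal:
  assumes quad: "quadratic_ideal (tangent_ideal a :: ('n, 'k::field) mpoly set)"
  shows "groebner_basis a (reducer ` nonstandard_quadrics) (tangent_ideal a :: ('n, 'k) mpoly set)"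
  unfolding groebner_basis_def
proof (intro conjI subset_antisym)
  let ?G = "reducer ` nonstandard_quadrics :: ('n, 'k) mpoly set"
  let ?LG = "{single (lead_monom a g) (1 :: 'k) |g. g \<in> ?G \<and> g \<noteq> 0}"
  let ?LI = "{single (lead_monom a f) (1 :: 'k) |f. f \<in> tangent_ideal a \<and> (f :: ('n, 'k) mpoly) \<noteq> 0}"
  show "finite ?G"
    using finite_nonstandard_quadrics by simp
  show "?G \<subseteq> tangent_ideal a"
    using reducer_in_tangent_ideal by blast
  then have "?LG \<subseteq> ?LI"
    by blast
  then show "ideal_gen ?LG \<subseteq> ideal_gen ?LI"
    using ideal_gen_superset[of ?LI] by (intro ideal_gen_subset is_ideal_ideal_gen) blast
  show "ideal_gen ?LI \<subseteq> ideal_gen ?LG"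
  proof (rule ideal_gen_subset[OF is_ideal_ideal_gen], rule subsetI)
    fix m
    assume "m \<in> ?LI"
    then obtain f :: "('n, 'k) mpoly"
      where f: "f \<in> tangent_ideal a" "f \<noteq> 0" "m = single (lead_monom a f) 1"
      by blast
    obtain \<mu> \<gamma> where \<mu>: "\<mu> \<in> nonstandard_quadrics" "lead_monom a f = \<mu> + \<gamma>"
      using nonstandard_multiple[OF quad lead_monom_nonstandard[OF f(1,2)]]
        nonstandard_quadrics_supset[OF quad] by (metis subsetD)
    have ns: "\<not> standard \<mu>"
      using \<mu>(1) by (simp add: nonstandard_quadrics_def)
    have "single \<mu> (1 :: 'k) \<in> ?LG"
      using \<mu>(1) reducer_nonzero[OF ns] lead_monom_reducer[OF ns, where 'k = 'k]
      by (intro CollectI exI[of _ "reducer \<mu>"]) auto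
    then have "single \<gamma> 1 * single \<mu> (1 :: 'k) \<in> ideal_gen ?LG"
      using ideal_gen_superset[of ?LG] by (intro is_idealD(3) is_ideal_ideal_gen) blast
    then show "m \<in> ideal_gen ?LG"
      by (simp add: f(3) \<mu>(2) mult_single add.commute)
  qed
qed

end

end

theorem theorem1p9:
  fixes H :: "nat set" and a :: "'n::finite \<Rightarrow> nat"
  assumes "numerical_semigroup H"
    and "inj a"
    and "minimal_gen_set H (range a)"
    and "quadratic_ideal (tangent_ideal a :: ('n, 'k::field) mpoly set)"
    and "cohen_macaulay_quot (tangent_ideal a :: ('n, 'k) mpoly set)"
  shows "((CARD('n) \<le> Min (range a) \<and> Min (range a) \<le> 2 ^ (CARD('n) - 1) - 2 ^ (CARD('n) - 3))
           \<or> Min (range a) = 2 ^ (CARD('n) - 1))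
       \<and> (Min (range a) = 2 ^ (CARD('n) - 1) - 2 ^ (CARD('n) - 3) \<longrightarrow>
           almost_complete_intersection (tangent_ideal a :: ('n, 'k) mpoly set) \<and>
           (\<exists>G. groebner_basis a G (tangent_ideal a :: ('n, 'k) mpoly set) \<and>
                (\<forall>g\<in>G. g \<noteq> 0 \<and> homogeneous 2 g)))"
proof -
  note quad = assms(4)
  interpret numerical_semigroup_gens a H
    by unfold_locales (use assms in auto)
  interpret regular_semigroup_gens a H
    by unfold_locales (rule cohen_macaulay_maximal_shift[OF assms(5)])
  consider (full) "a i0 = 2 ^ (CARD('n) - 1)"
    | (pair) p q where "p \<noteq> i0" "q \<noteq> i0" "p \<noteq> q" "\<not> standard (xvar p + xvar q)"
    by (rule multiplicity_cases[OF quad])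
  then show ?thesis
  proof cases
    case full
    \<comment> \<open>Even where the exponent is truncated to 0, the subtracted power is positive,
      so this case excludes the extremal value.\<close>
    moreover have "2 ^ (CARD('n) - 1) - 2 ^ (CARD('n) - 3) < (2 ^ (CARD('n) - 1) :: nat)"
      by (rule diff_less) simp_all
    ultimately have "a i0 \<noteq> 2 ^ (CARD('n) - 1) - 2 ^ (CARD('n) - 3)"
      by linarith
    then show ?thesis
      unfolding Min_gens using full by blast
  next
    case (pair p q)
    have "almost_complete_intersection (tangent_ideal a :: ('n, 'k) mpoly set) \<and>
        (\<exists>G. groebner_basis a G (tangent_ideal a :: ('n, 'k) mpoly set) \<and>
          (\<forall>g\<in>G. g \<noteq> 0 \<and> homogeneous 2 g))"
      if extremal: "a i0 = 2 ^ (CARD('n) - 1) - 2 ^ (CARD('n) - 3)"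
    proof (intro conjI exI[of _ "reducer ` nonstandard_quadrics"] ballI)
      show "almost_complete_intersection (tangent_ideal a :: ('n, 'k) mpoly set)"
        by (rule almost_complete_intersection_extremal[OF pair extremal quad])
      show "groebner_basis a (reducer ` nonstandard_quadrics) (tangent_ideal a :: ('n, 'k) mpoly set)"
        by (rule groebner_basis_extremal[OF pair extremal quad])
      fix g :: "('n, 'k) mpoly"
      assume "g \<in> reducer ` nonstandard_quadrics"
      then obtain \<mu> where \<mu>: "g = reducer \<mu>" "\<not> standard \<mu>" "mdeg \<mu> = 2"
        by (auto simp: nonstandard_quadrics_def)
      then show "g \<noteq> 0"
        by (simp add: reducer_nonzero)
      show "homogeneous 2 g"
        using homogeneous_reducer[of \<mu>, where 'k = 'k] \<mu> by simp
    qed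
    then show ?thesis
      using multiplicity_le_if_pair[OF quad pair] embdim_le_multiplicity by (simp add: Min_gens)
  qed
qed

end
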